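(* Let $F$ be a field and, for $j\in\{1,\dots,s\}$, let $F * B_j$ be twisted group algebras over $F$ with $B_j\cong\mathbb Z^2$. Then $$\dim(F * B_1\otimes_F F * B_2\otimes_F\cdots\otimes_F F * B_s)=\sum_{j=1}^s\dim(F * B_j).$$
   Context: A twisted group algebra $F * B$ is an $F$-algebra with $F$-basis $\{\bar b: b\in B\}$ and $\bar b_1\bar b_2=\tau(b_1,b_2)\overline{b_1b_2}$, $\tau$ a 2-cocycle with values in $F\setminus\{0\}$; tensor products of such algebras are twisted group algebras of the direct product. $\dim$ denotes the Krull dimension, which for these algebras coincides with the global dimension. *)

theory Defs
  imports Main "HOL-Library.Function_Algebras" "HOL-Library.Product_Plus"
          "HOL-Library.Extended_Nat"
begin

definition is_cocycle :: "'g::ab_group_add set \<Rightarrow> ('g \<Rightarrow> 'g \<Rightarrow> 'a::field) \<Rightarrow> bool" where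
  "is_cocycle G tau \<longleftrightarrow>
     (\<forall>a\<in>G. \<forall>b\<in>G. tau a b \<noteq> 0) \<and>
     (\<forall>a\<in>G. \<forall>b\<in>G. \<forall>c\<in>G. tau a b * tau (a + b) c = tau b c * tau a (b + c))"

definition tga_carrier :: "'g set \<Rightarrow> ('g \<Rightarrow> 'a::zero) set" where
  "tga_carrier G = {f. finite {x. f x \<noteq> 0} \<and> {x. f x \<noteq> 0} \<subseteq> G}"

definition tga_mult :: "('g::plus \<Rightarrow> 'g \<Rightarrow> 'a::field) \<Rightarrow> ('g \<Rightarrow> 'a) \<Rightarrow> ('g \<Rightarrow> 'a) \<Rightarrow> ('g \<Rightarrow> 'a)" where
  "tga_mult tau f g = (\<lambda>c. \<Sum>(a, b) \<in> {(a, b). f a \<noteq> 0 \<and> g b \<noteq> 0 \<and> a + b = c}.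
                              f a * g b * tau a b)"

definition tga_right_ideals :: "'g::ab_group_add set \<Rightarrow> ('g \<Rightarrow> 'g \<Rightarrow> 'a::field) \<Rightarrow> ('g \<Rightarrow> 'a) set set" where
  "tga_right_ideals G tau = {I. I \<subseteq> tga_carrier G \<and> 0 \<in> I \<and>
      (\<forall>x\<in>I. \<forall>y\<in>I. x + y \<in> I) \<and> (\<forall>x\<in>I. - x \<in> I) \<and>
      (\<forall>x\<in>I. \<forall>r\<in>tga_carrier G. tga_mult tau x r \<in> I)}"

text \<open>Deviation of a poset of sets ordered by inclusion (Gabriel--Rentschler),
  finite levels only. dev_less n L means dev L < n - 1 (dev of a trivial poset is
  -infinity): dev_less 0 L iff L has no strict pair; dev_less (Suc n) L iff every
  descending chain has all but finitely many factors [a (i+1), a i] with dev_less n.\<close>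

fun dev_less :: "nat \<Rightarrow> 'x set set \<Rightarrow> bool" where
  "dev_less 0 L = (\<forall>x\<in>L. \<forall>y\<in>L. x \<subseteq> y \<longrightarrow> x = y)"
| "dev_less (Suc n) L =
     (\<forall>a :: nat \<Rightarrow> 'x set. (\<forall>i. a i \<in> L \<and> a (Suc i) \<subseteq> a i) \<longrightarrow>
        (\<exists>N. \<forall>i\<ge>N. dev_less n {x\<in>L. a (Suc i) \<subseteq> x \<and> x \<subseteq> a i}))"

text \<open>dev_less (Suc n) L holds iff dev L \<le> n (with dev = -infinity for trivial L).
  Krull dimension: the deviation, as an extended natural (infinite ordinal values
  and non-existence of deviation are mapped to infinity).\<close>

definition poset_krull_dim :: "'x set set \<Rightarrow> enat" where
  "poset_krull_dim L = (if \<exists>n. dev_less (Suc n) L then enat (LEAST n. dev_less (Suc n) L) else \<infinity>)"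

definition tga_krull_dim :: "'g::ab_group_add set \<Rightarrow> ('g \<Rightarrow> 'g \<Rightarrow> 'a::field) \<Rightarrow> enat" where
  "tga_krull_dim G tau = poset_krull_dim (tga_right_ideals G tau)"

text \<open>Z^(2s) as functions nat -> Z^2 vanishing from index s on, and the product
  cocycle describing the tensor product of the F * B_j.\<close>

definition Zpow2 :: "nat \<Rightarrow> (nat \<Rightarrow> int \<times> int) set" where
  "Zpow2 s = {x. \<forall>i\<ge>s. x i = 0}"

definition prod_cocycle :: "nat \<Rightarrow> (nat \<Rightarrow> (int \<times> int) \<Rightarrow> (int \<times> int) \<Rightarrow> 'a::field)
    \<Rightarrow> (nat \<Rightarrow> int \<times> int) \<Rightarrow> (nat \<Rightarrow> int \<times> int) \<Rightarrow> 'a" where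
  "prod_cocycle s tau x y = (\<Prod>j<s. tau j (x j) (y j))"

end

theory Submission
  imports Defs "HOL-Library.Fun_Lexorder" "HOL-Algebra.Group"
begin

text \<open>
  A cocycle on \<open>\<int>\<^sup>2\<close> is cohomologous to \<open>(a, b) \<mapsto> q\<^bsup>a\<^sub>2 b\<^sub>1\<^esup>\<close>, so both sides are statements about
  quantum tori given by scalars \<open>q\<^sub>j\<close>, and each has dimension \<open>\<Sum>\<^sub>j d\<^sub>j\<close> with \<open>d\<^sub>j = 2\<close> if \<open>q\<^sub>j\<close> is a
  root of unity and \<open>d\<^sub>j = 1\<close> otherwise.

  Lower bound: \<open>x\<^sub>j\<close>, together with \<open>y\<^sub>j\<^sup>N\<close> when \<open>q\<^sub>j\<^sup>N = 1\<close>, generate a commutative Laurent polynomial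
  ring, over which the torus is free; the elements \<open>x - 1\<close> form a regular sequence, and every regular
  element \<open>t\<close> acting on \<open>R / N\<close> raises the deviation by one through the chain \<open>t\<^sup>i R + N\<close>.

  Upper bound: sending a right ideal to the set of leading exponents of its elements supported in
  \<open>\<nat>\<^sup>n\<close> is strictly monotone, and a subquotient \<open>J / I\<close> has a growth dimension, the largest
  dimension of an orthant in the difference of exponent sets. Along a descending chain in \<open>J / I\<close>
  almost all factors have smaller growth dimension, so the deviation is at most \<open>n - m\<close> if all nonzero
  subquotients have growth dimension at least \<open>m\<close>. As for the Weyl algebra (Joseph's proof of
  Bernstein's inequality), this holds with \<open>m\<close> the number of \<open>q\<^sub>j\<close> of infinite order: a nonzero
  element of the \<open>2m\<close>-dimensional subtorus with exponents in a box of side \<open>k\<close> cannot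
  annihilate the first \<open>O(k)\<close> layers of a nonzero cyclic module, so the square of the growth
  function of the module is at least \<open>k\<^sup>2\<^sup>m\<close>.
\<close>


section \<open>Deviation of posets\<close>

text \<open>Chains go to chains, and each interval between consecutive members is mapped strictly
  monotonically into the corresponding interval of the target, so induction on the level applies.
  Inclusions of posets, the lower bound and transport along isomorphisms all use this.\<close>

lemma dev_less_strict_embedding:
  fixes \<phi> :: "'x set \<Rightarrow> 'y set"
  assumes "dev_less n L'"
    and "\<And>x. x \<in> L \<Longrightarrow> \<phi> x \<in> L'"
    and "\<And>x y. x \<in> L \<Longrightarrow> y \<in> L \<Longrightarrow> x \<subset> y \<Longrightarrow> \<phi> x \<subset> \<phi> y"
  shows "dev_less n L"
  using assms
proof (induction n arbitrary: L L')
  case 0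
  show ?case
  proof (simp, intro ballI impI)
    fix x y assume xy: "x \<in> L" "y \<in> L" "x \<subseteq> y"
    show "x = y"
    proof (rule ccontr)
      assume "x \<noteq> y"
      then have "\<phi> x \<subset> \<phi> y" using xy "0.prems"(3) by blast
      moreover have "\<phi> x \<in> L'" "\<phi> y \<in> L'" using xy "0.prems"(2) by auto
      ultimately show False using "0.prems"(1) by auto
    qed
  qed
next
  case (Suc n)
  have mono: "\<phi> x \<subseteq> \<phi> y" if "x \<in> L" "y \<in> L" "x \<subseteq> y" for x y
    using that Suc.prems(3)[of x y] by (cases "x = y") auto
  show ?case
  proof (simp, intro allI impI)
    fix a :: "nat \<Rightarrow> 'x set" assume a: "\<forall>i. a i \<in> L \<and> a (Suc i) \<subseteq> a i"
    have "\<forall>i. \<phi> (a i) \<in> L' \<and> \<phi> (a (Suc i)) \<subseteq> \<phi> (a i)"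
      using a mono Suc.prems(2) by blast
    moreover have "\<forall>b. (\<forall>i. b i \<in> L' \<and> b (Suc i) \<subseteq> b i) \<longrightarrow>
        (\<exists>N. \<forall>i\<ge>N. dev_less n {x \<in> L'. b (Suc i) \<subseteq> x \<and> x \<subseteq> b i})"
      using Suc.prems(1) by simp
    ultimately obtain N where
      N: "\<forall>i\<ge>N. dev_less n {x \<in> L'. \<phi> (a (Suc i)) \<subseteq> x \<and> x \<subseteq> \<phi> (a i)}"
      by (elim allE[of _ "\<lambda>i. \<phi> (a i)"]) blast
    have "dev_less n {x \<in> L. a (Suc i) \<subseteq> x \<and> x \<subseteq> a i}" if "i \<ge> N" for i
    proof (rule Suc.IH)
      show "dev_less n {x \<in> L'. \<phi> (a (Suc i)) \<subseteq> x \<and> x \<subseteq> \<phi> (a i)}" using N that by blast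
    qed (use a mono Suc.prems in auto)
    then show "\<exists>N. \<forall>i\<ge>N. dev_less n {x \<in> L. a (Suc i) \<subseteq> x \<and> x \<subseteq> a i}" by blast
  qed
qed

lemma dev_less_subset: "dev_less n L' \<Longrightarrow> L \<subseteq> L' \<Longrightarrow> dev_less n L"
  using dev_less_strict_embedding[of n L' L "\<lambda>x. x"] by (auto simp del: dev_less.simps)

lemma dev_less_Suc: "dev_less n L \<Longrightarrow> dev_less (Suc n) L"
proof (induction n arbitrary: L)
  case 0
  show ?case
    unfolding dev_less.simps(2)
    by (intro allI impI exI[of _ 0]) (rule dev_less_subset[OF 0], auto)
next
  case (Suc n)
  show ?case
    unfolding dev_less.simps(2)[of "Suc n"]
  proof (intro allI impI)
    fix a :: "nat \<Rightarrow> 'a set" assume "\<forall>i. a i \<in> L \<and> a (Suc i) \<subseteq> a i"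
    then have "\<exists>N. \<forall>i\<ge>N. dev_less n {x \<in> L. a (Suc i) \<subseteq> x \<and> x \<subseteq> a i}"
      using Suc.prems by simp
    then show "\<exists>N. \<forall>i\<ge>N. dev_less (Suc n) {x \<in> L. a (Suc i) \<subseteq> x \<and> x \<subseteq> a i}"
      using Suc.IH by blast
  qed
qed

lemma dev_less_le: "dev_less m L \<Longrightarrow> m \<le> n \<Longrightarrow> dev_less n L"
  by (induction n) (auto simp: le_Suc_eq intro: dev_less_Suc simp del: dev_less.simps)

text \<open>The shift by one in \<open>dev_less\<close> makes the hypotheses say that the deviation
  is at most \<open>r\<close> and at least \<open>r\<close>; for \<open>r = 0\<close> the second one
  says that \<open>L\<close> has a strict pair.\<close>

lemma poset_krull_dim_eqI:
  assumes "dev_less (Suc r) L" and "\<not> dev_less r L"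
  shows "poset_krull_dim L = enat r"
proof -
  have "(LEAST n. dev_less (Suc n) L) = r"
  proof (rule Least_equality)
    show "dev_less (Suc r) L" by (rule assms)
    fix n assume "dev_less (Suc n) L"
    then show "r \<le> n" using assms(2) dev_less_le[of "Suc n" L r] by (meson not_less_eq_eq)
  qed
  then show ?thesis using assms(1) unfolding poset_krull_dim_def by metis
qed

lemma poset_krull_dim_cong:
  assumes "\<And>n. dev_less n L \<longleftrightarrow> dev_less n L'"
  shows "poset_krull_dim L = poset_krull_dim L'"
  unfolding poset_krull_dim_def by (simp only: assms)

section \<open>Linear algebra modulo a subspace\<close>

text \<open>Gaussian elimination with \<open>P\<close> indexing unknowns and \<open>E\<close>
  equations: an unknown \<open>r\<close> that occurs in equation \<open>e\<close> is eliminated, and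
  both counts drop by one.\<close>

lemma homogeneous_system_nontrivial:
  fixes A :: "'p \<Rightarrow> 'e \<Rightarrow> 'a::field"
  assumes "finite E" "finite P" "card E < card P"
  shows "\<exists>\<mu>. (\<exists>p\<in>P. \<mu> p \<noteq> 0) \<and> (\<forall>e\<in>E. (\<Sum>p\<in>P. \<mu> p * A p e) = 0)"
  using assms
proof (induction E arbitrary: P A rule: finite_induct)
  case empty
  then have "P \<noteq> {}" by auto
  then show ?case by (intro exI[of _ "\<lambda>_. 1"]) auto
next
  case (insert e E)
  show ?case
  proof (cases "\<forall>p\<in>P. A p e = 0")
    case True
    have "card E < card P" using insert by simp
    then show ?thesis using insert.IH[OF insert.prems(1), of A] True by auto
  next
    case False
    then obtain r where r: "r \<in> P" "A r e \<noteq> 0" by blast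
    let ?P = "P - {r}"
    have "card E < card ?P" using insert r by simp
    then obtain \<mu> where \<mu>: "\<exists>p\<in>?P. \<mu> p \<noteq> 0"
      "\<forall>e'\<in>E. (\<Sum>p\<in>?P. \<mu> p * (A p e' - A p e / A r e * A r e')) = 0"
      using insert.IH[of ?P "\<lambda>p e'. A p e' - A p e / A r e * A r e'"] insert.prems by auto
    \<comment> \<open>The value of the unknown \<open>r\<close> that makes equation \<open>e\<close>
      hold.\<close>
    define c where "c = - (\<Sum>p\<in>?P. \<mu> p * A p e) / A r e"
    define \<nu> where "\<nu> = \<mu>(r := c)"
    have split: "(\<Sum>p\<in>P. \<nu> p * A p x) = c * A r x + (\<Sum>p\<in>?P. \<mu> p * A p x)" for x
      using r(1) insert.prems(1) by (simp add: sum.remove \<nu>_def)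
    have "(\<Sum>p\<in>P. \<nu> p * A p x) = 0" if x: "x \<in> insert e E" for x
    proof (cases "x = e")
      case True
      then show ?thesis unfolding split c_def using r(2) by simp
    next
      case False
      have "c * A r x = - (\<Sum>p\<in>?P. \<mu> p * (A p e / A r e * A r x))"
        unfolding c_def by (simp add: sum_distrib_right sum_divide_distrib mult.assoc)
      then show ?thesis unfolding split using \<mu>(2) x False
        by (simp add: algebra_simps sum_subtractf)
    qed
    moreover have "\<exists>p\<in>P. \<nu> p \<noteq> 0" using \<mu>(1) by (auto simp: \<nu>_def)
    ultimately show ?thesis by blast
  qed
qed

definition lincomb :: "'t set \<Rightarrow> ('t \<Rightarrow> 'a::field) \<Rightarrow> ('t \<Rightarrow> 'g \<Rightarrow> 'a) \<Rightarrow> 'g \<Rightarrow> 'a" where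
  "lincomb T \<mu> v = (\<lambda>x. \<Sum>t\<in>T. \<mu> t * v t x)"

definition lin_subspace :: "('g \<Rightarrow> 'a::field) set \<Rightarrow> bool" where
  "lin_subspace I \<longleftrightarrow> 0 \<in> I \<and> (\<forall>f\<in>I. \<forall>g\<in>I. f + g \<in> I) \<and> (\<forall>f\<in>I. \<forall>c. (\<lambda>x. c * f x) \<in> I)"

lemma lin_subspace_diff: "lin_subspace I \<Longrightarrow> f \<in> I \<Longrightarrow> g \<in> I \<Longrightarrow> f - g \<in> I"
proof -
  assume I: "lin_subspace I" "f \<in> I" "g \<in> I"
  have "f - g = f + (\<lambda>x. - 1 * g x)" by (auto simp: fun_eq_iff)
  then show ?thesis using I unfolding lin_subspace_def by metis
qed

lemma lin_subspace_lincomb: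
  assumes "lin_subspace I" "\<And>t. t \<in> T \<Longrightarrow> v t \<in> I"
  shows "lincomb T \<mu> v \<in> I"
  using assms(2)
proof (induction T rule: infinite_finite_induct)
  case (insert t T)
  have "lincomb (insert t T) \<mu> v = (\<lambda>x. \<mu> t * v t x) + lincomb T \<mu> v"
    using insert by (simp add: lincomb_def fun_eq_iff)
  moreover have "(\<lambda>x. \<mu> t * v t x) \<in> I" "lincomb T \<mu> v \<in> I"
    using insert assms(1) by (auto simp: lin_subspace_def)
  ultimately show ?case using assms(1) unfolding lin_subspace_def by metis
qed (use assms(1) in \<open>auto simp: lincomb_def lin_subspace_def zero_fun_def\<close>)

lemma lincomb_fun_upd:
  assumes "finite T" "e \<in> T"
  shows "lincomb T (\<mu>(e := \<mu> e + c)) v = (\<lambda>x. c * v e x) + lincomb T \<mu> v"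
proof
  fix x
  have "(\<Sum>t\<in>T - {e}. (\<mu>(e := \<mu> e + c)) t * v t x) = (\<Sum>t\<in>T - {e}. \<mu> t * v t x)"
    by (rule sum.cong) auto
  then show "lincomb T (\<mu>(e := \<mu> e + c)) v x = ((\<lambda>x. c * v e x) + lincomb T \<mu> v) x"
    by (simp add: lincomb_def sum.remove[OF assms] distrib_right)
qed

text \<open>Replacing each \<open>v b\<close> by its expansion in the \<open>g e\<close> and
  exchanging sums leaves only coefficients that vanish by assumption.\<close>

lemma lincomb_mod_spanning:
  assumes I: "lin_subspace I"
    and span: "\<And>b. b \<in> B \<Longrightarrow> v b - lincomb E (\<gamma> b) g \<in> I"
    and 0: "\<And>e. e \<in> E \<Longrightarrow> (\<Sum>b\<in>B. \<mu> b * \<gamma> b e) = 0"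
  shows "lincomb B \<mu> v \<in> I"
proof -
  have "lincomb B \<mu> (\<lambda>b. v b - lincomb E (\<gamma> b) g) \<in> I"
    using I span by (rule lin_subspace_lincomb)
  also have "lincomb B \<mu> (\<lambda>b. v b - lincomb E (\<gamma> b) g) = lincomb B \<mu> v"
  proof
    fix x
    have "(\<Sum>b\<in>B. \<mu> b * (\<Sum>e\<in>E. \<gamma> b e * g e x)) = (\<Sum>e\<in>E. (\<Sum>b\<in>B. \<mu> b * \<gamma> b e) * g e x)"
      unfolding sum_distrib_left sum_distrib_right by (subst sum.swap) (simp add: mult.assoc)
    also have "\<dots> = 0" using 0 by simp
    finally show "lincomb B \<mu> (\<lambda>b. v b - lincomb E (\<gamma> b) g) x = lincomb B \<mu> v x"
      by (simp add: lincomb_def algebra_simps sum_subtractf)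
  qed
  finally show ?thesis .
qed

text \<open>\<open>T\<close> is a subfamily of maximal size independent modulo \<open>I\<close>;
  maximality makes it spanning. More than \<open>card E\<close> vectors in the span of the
  \<open>g e\<close> would satisfy a nontrivial relation modulo \<open>I\<close>.\<close>

lemma spanning_subfamily_mod:
  fixes v :: "'b \<Rightarrow> 'g \<Rightarrow> 'a::field"
  assumes I: "lin_subspace I" and fin: "finite B" "finite E"
    and span: "\<And>b. b \<in> B \<Longrightarrow> v b - lincomb E (\<gamma> b) g \<in> I"
  obtains T where "T \<subseteq> B" "card T \<le> card E"
    "\<And>b. b \<in> B \<Longrightarrow> \<exists>\<mu>. v b - lincomb T \<mu> v \<in> I"
proof -
  define ind where "ind T \<longleftrightarrow> T \<subseteq> B \<and> (\<forall>\<mu>. lincomb T \<mu> v \<in> I \<longrightarrow> (\<forall>t\<in>T. \<mu> t = 0))" for T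
  have "ind {}" by (simp add: ind_def)
  moreover have "\<forall>T. ind T \<longrightarrow> card T < Suc (card B)"
    using fin(1) by (auto simp: ind_def less_Suc_eq_le intro: card_mono)
  ultimately obtain T where T: "ind T" and max: "\<And>T'. ind T' \<Longrightarrow> card T' \<le> card T"
    using ex_has_greatest_nat[of ind "{}" card "Suc (card B)"] by auto
  have TB: "T \<subseteq> B" and finT: "finite T" using T fin(1) finite_subset by (auto simp: ind_def)
  have "card T \<le> card E"
  proof (rule ccontr)
    assume "\<not> card T \<le> card E"
    then obtain \<mu> where \<mu>: "\<exists>t\<in>T. \<mu> t \<noteq> 0" "\<forall>e\<in>E. (\<Sum>t\<in>T. \<mu> t * \<gamma> t e) = 0"
      using homogeneous_system_nontrivial[OF fin(2) finT, of \<gamma>] by auto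
    then have "lincomb T \<mu> v \<in> I"
      using lincomb_mod_spanning[OF I, of T v E \<gamma> g \<mu>] span TB by blast
    then show False using T \<mu>(1) by (auto simp: ind_def)
  qed
  moreover have "\<exists>\<mu>. v b - lincomb T \<mu> v \<in> I" if b: "b \<in> B" for b
  proof (cases "b \<in> T")
    case True
    have "v b - lincomb T (\<lambda>t. if t = b then 1 else 0) v = 0"
      using True finT by (auto simp: lincomb_def fun_eq_iff if_distrib[of "\<lambda>c. c * _"] cong: if_cong)
    then show ?thesis using I unfolding lin_subspace_def by metis
  next
    case False
    have "\<not> ind (insert b T)" using max[of "insert b T"] False finT by auto
    then obtain \<mu> where \<mu>: "lincomb (insert b T) \<mu> v \<in> I" "\<exists>t\<in>insert b T. \<mu> t \<noteq> 0"
      using TB b by (auto simp: ind_def)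
    have eq: "lincomb (insert b T) \<mu> v = (\<lambda>x. \<mu> b * v b x) + lincomb T \<mu> v"
      using False finT by (simp add: lincomb_def fun_eq_iff)
    \<comment> \<open>Otherwise the relation would involve \<open>T\<close> alone, and independence
      would make it trivial.\<close>
    have nz: "\<mu> b \<noteq> 0"
    proof
      assume "\<mu> b = 0"
      then have "lincomb (insert b T) \<mu> v = lincomb T \<mu> v" using eq by (simp add: fun_eq_iff)
      then show False using T \<mu> \<open>\<mu> b = 0\<close> by (auto simp: ind_def)
    qed
    have "(\<lambda>x. inverse (\<mu> b) * lincomb (insert b T) \<mu> v x) \<in> I"
      using I \<mu>(1) unfolding lin_subspace_def by blast
    also have "(\<lambda>x. inverse (\<mu> b) * lincomb (insert b T) \<mu> v x)
        = v b - lincomb T (\<lambda>t. - inverse (\<mu> b) * \<mu> t) v"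
      unfolding eq using nz
      by (auto simp: fun_eq_iff lincomb_def algebra_simps sum_distrib_left sum_negf)
    finally show ?thesis by blast
  qed
  ultimately show thesis using TB that by blast
qed


section \<open>Quantum tori with a bicharacter cocycle\<close>

definition Zn :: "nat \<Rightarrow> (nat \<Rightarrow> int) set" where
  "Zn n = {x. \<forall>i\<ge>n. x i = 0}"

lemma Zn_add [simp]: "x \<in> Zn n \<Longrightarrow> y \<in> Zn n \<Longrightarrow> x + y \<in> Zn n"
  and Zn_diff [simp]: "x \<in> Zn n \<Longrightarrow> y \<in> Zn n \<Longrightarrow> x - y \<in> Zn n"
  and Zn_uminus [simp]: "x \<in> Zn n \<Longrightarrow> - x \<in> Zn n"
  and Zn_0 [simp]: "0 \<in> Zn n"
  by (auto simp: Zn_def)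

text \<open>A bicharacter is in particular a 2-cocycle. Multiplicativity is required on all integer
  sequences, which keeps membership in \<open>Zn n\<close> out of computations with
  coefficients.\<close>

locale bichar_torus =
  fixes n :: nat and \<beta> :: "(nat \<Rightarrow> int) \<Rightarrow> (nat \<Rightarrow> int) \<Rightarrow> 'a::field"
  assumes \<beta>_add_left: "\<beta> (a + b) c = \<beta> a c * \<beta> b c"
    and \<beta>_add_right: "\<beta> a (b + c) = \<beta> a b * \<beta> a c"
    and \<beta>_nz [simp]: "\<beta> a b \<noteq> 0"
begin

abbreviation "G \<equiv> Zn n"
abbreviation "C \<equiv> tga_carrier (Zn n) :: ((nat \<Rightarrow> int) \<Rightarrow> 'a) set"
abbreviation "L \<equiv> tga_right_ideals (Zn n) \<beta>"

lemma \<beta>_0_left [simp]: "\<beta> 0 a = 1"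
  using \<beta>_add_left[of 0 0 a] by simp

lemma \<beta>_0_right [simp]: "\<beta> a 0 = 1"
  using \<beta>_add_right[of a 0 0] by simp

lemma \<beta>_diff_left: "\<beta> (a - b) c = \<beta> a c / \<beta> b c"
  using \<beta>_add_left[of "a - b" b c] by (simp add: field_simps)

lemma \<beta>_diff_right: "\<beta> a (b - c) = \<beta> a b / \<beta> a c"
  using \<beta>_add_right[of a "b - c" c] by (simp add: field_simps)

text \<open>Right multiplication by the basis element of \<open>p\<close>, as a weighted translation
  of coefficient functions; \<open>lmul h\<close> below is left multiplication by the basis element
  of \<open>h\<close>.\<close>

definition rmul :: "(nat \<Rightarrow> int) \<Rightarrow> ((nat \<Rightarrow> int) \<Rightarrow> 'a) \<Rightarrow> (nat \<Rightarrow> int) \<Rightarrow> 'a" where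
  "rmul p f = (\<lambda>x. f (x - p) * \<beta> (x - p) p)"

definition lmul :: "(nat \<Rightarrow> int) \<Rightarrow> ((nat \<Rightarrow> int) \<Rightarrow> 'a) \<Rightarrow> (nat \<Rightarrow> int) \<Rightarrow> 'a" where
  "lmul h f = (\<lambda>x. \<beta> h (x - h) * f (x - h))"

lemma rmul_rmul: "rmul p' (rmul p f) = (\<lambda>x. \<beta> p p' * rmul (p + p') f x)"
  by (simp add: rmul_def fun_eq_iff \<beta>_diff_left \<beta>_add_left \<beta>_add_right diff_diff_eq add.commute[of p' p] mult_ac)

lemma rmul_0 [simp]: "rmul 0 f = f"
  by (simp add: rmul_def)

lemma rmul_lmul: "rmul p (lmul h f) = lmul h (rmul p f)"
  by (simp add: rmul_def lmul_def fun_eq_iff \<beta>_diff_left \<beta>_diff_right diff_diff_eq add.commute[of p h] mult_ac)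

lemma rmul_lincomb: "rmul p (lincomb T \<mu> v) = lincomb T \<mu> (\<lambda>t. rmul p (v t))"
  by (simp add: rmul_def lincomb_def sum_distrib_right mult.assoc)

lemma rmul_scale: "rmul p (\<lambda>x. c * f x) = (\<lambda>x. c * rmul p f x)"
  by (simp add: rmul_def mult.assoc)

lemma rmul_add: "rmul p (f + g) = rmul p f + rmul p g"
  and rmul_diff: "rmul p (f - g) = rmul p f - rmul p g"
  by (simp_all add: rmul_def fun_eq_iff algebra_simps)

section \<open>Right ideals as stable subspaces\<close>

lemma C_finite: "f \<in> C \<Longrightarrow> finite {x. f x \<noteq> 0}"
  and C_supp: "f \<in> C \<Longrightarrow> f x \<noteq> 0 \<Longrightarrow> x \<in> G"
  by (auto simp: tga_carrier_def)

lemma C_subspace: "lin_subspace C"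
  unfolding lin_subspace_def
proof (intro conjI ballI allI)
  show "0 \<in> C" by (simp add: tga_carrier_def)
  fix f :: "(nat \<Rightarrow> int) \<Rightarrow> 'a" assume f: "f \<in> C"
  {
    fix g :: "(nat \<Rightarrow> int) \<Rightarrow> 'a" assume g: "g \<in> C"
    have "{x. (f + g) x \<noteq> 0} \<subseteq> {x. f x \<noteq> 0} \<union> {x. g x \<noteq> 0}" by auto
    then show "f + g \<in> C" using f g unfolding tga_carrier_def
      by (auto intro: finite_subset)
  next
    fix c
    have "{x. c * f x \<noteq> 0} \<subseteq> {x. f x \<noteq> 0}" by auto
    then show "(\<lambda>x. c * f x) \<in> C" using f unfolding tga_carrier_def
      by (auto intro: finite_subset)
  }
qed

lemma shift_in_C:
  assumes "f \<in> C" "p \<in> G" shows "(\<lambda>x. w x * f (x - p)) \<in> C"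
proof -
  have sub: "{x. w x * f (x - p) \<noteq> 0} \<subseteq> (\<lambda>x. x + p) ` {x. f x \<noteq> 0}"
    by (auto simp: image_iff intro!: exI[of _ "_ - p"])
  moreover have "(\<lambda>x. x + p) ` {x. f x \<noteq> 0} \<subseteq> G" using assms by (auto simp: tga_carrier_def)
  ultimately show ?thesis using assms(1) unfolding tga_carrier_def
    by (simp add: finite_subset subset_trans)
qed

lemma rmul_in_C: "f \<in> C \<Longrightarrow> p \<in> G \<Longrightarrow> rmul p f \<in> C"
  using shift_in_C[of f p "\<lambda>x. \<beta> (x - p) p"] by (simp add: rmul_def mult.commute)

lemma lmul_in_C: "f \<in> C \<Longrightarrow> p \<in> G \<Longrightarrow> lmul p f \<in> C"
  using shift_in_C[of f p "\<lambda>x. \<beta> p (x - p)"] by (simp add: lmul_def)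

lemma tga_mult_monomial:
  "tga_mult \<beta> f (\<lambda>x. if x = p then c else 0) = (\<lambda>x. c * rmul p f x)"
proof
  fix x
  have "{(a, b). f a \<noteq> 0 \<and> (if b = p then c else 0) \<noteq> 0 \<and> a + b = x}
      = (if c \<noteq> 0 \<and> f (x - p) \<noteq> 0 then {(x - p, p)} else {})"
    by (auto split: if_splits)
  then show "tga_mult \<beta> f (\<lambda>x. if x = p then c else 0) x = c * rmul p f x"
    by (auto simp: tga_mult_def rmul_def)
qed

lemma tga_mult_eq_lincomb:
  assumes "r \<in> C"
  shows "tga_mult \<beta> f r = lincomb {x. r x \<noteq> 0} r (\<lambda>p. rmul p f)"
proof
  fix x
  let ?A = "{(a, b). f a \<noteq> 0 \<and> r b \<noteq> 0 \<and> a + b = x}"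
  let ?B = "{b. r b \<noteq> 0 \<and> f (x - b) \<noteq> 0}"
  have "tga_mult \<beta> f r x = (\<Sum>b\<in>?B. r b * rmul b f x)"
    unfolding tga_mult_def
    by (rule sum.reindex_bij_witness[where i = "\<lambda>b. (x - b, b)" and j = snd])
      (auto simp: rmul_def)
  also have "\<dots> = (\<Sum>b | r b \<noteq> 0. r b * rmul b f x)"
    by (rule sum.mono_neutral_left) (use C_finite[OF assms] in \<open>auto simp: rmul_def\<close>)
  finally show "tga_mult \<beta> f r x = lincomb {x. r x \<noteq> 0} r (\<lambda>p. rmul p f) x"
    by (simp add: lincomb_def)
qed

text \<open>Basis elements span the algebra, and multiplication by a scalar multiple of the one at
  \<open>0\<close> is scaling. Hence right ideals can be handled by linear algebra and the operators
  \<open>rmul p\<close> alone.\<close>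

lemma right_ideal_iff:
  "I \<in> L \<longleftrightarrow> I \<subseteq> C \<and> lin_subspace I \<and> (\<forall>p\<in>G. \<forall>f\<in>I. rmul p f \<in> I)"
proof
  assume I: "I \<in> L"
  have mono: "(\<lambda>x. c * rmul p f x) \<in> I" if "f \<in> I" "p \<in> G" for f p c
  proof -
    have "(\<lambda>x. if x = p then c else 0) \<in> C" using that(2) by (auto simp: tga_carrier_def)
    then show ?thesis using I that(1) unfolding tga_right_ideals_def
      by (auto simp flip: tga_mult_monomial)
  qed
  have "rmul p f \<in> I" if "f \<in> I" "p \<in> G" for f p using mono[OF that, of 1] by simp
  moreover have "(\<lambda>x. c * f x) \<in> I" if "f \<in> I" for f c using mono[OF that, of 0 c] by simp
  ultimately show "I \<subseteq> C \<and> lin_subspace I \<and> (\<forall>p\<in>G. \<forall>f\<in>I. rmul p f \<in> I)"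
    using I by (auto simp: tga_right_ideals_def lin_subspace_def)
next
  assume I: "I \<subseteq> C \<and> lin_subspace I \<and> (\<forall>p\<in>G. \<forall>f\<in>I. rmul p f \<in> I)"
  have "- f \<in> I" if "f \<in> I" for f
    using lin_subspace_diff[of I 0 f] I that by (auto simp: lin_subspace_def)
  moreover have "tga_mult \<beta> f r \<in> I" if "f \<in> I" "r \<in> C" for f r
    unfolding tga_mult_eq_lincomb[OF that(2)]
    by (rule lin_subspace_lincomb) (use I that C_supp in auto)
  ultimately show "I \<in> L" using I by (auto simp: tga_right_ideals_def lin_subspace_def)
qed

lemma
  assumes "I \<in> L"
  shows ideal_C: "f \<in> I \<Longrightarrow> f \<in> C"
    and ideal_subspace: "lin_subspace I"
    and ideal_0: "0 \<in> I"
    and ideal_add: "f \<in> I \<Longrightarrow> g \<in> I \<Longrightarrow> f + g \<in> I"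
    and ideal_diff: "f \<in> I \<Longrightarrow> g \<in> I \<Longrightarrow> f - g \<in> I"
    and ideal_scale: "f \<in> I \<Longrightarrow> (\<lambda>x. c * f x) \<in> I"
    and ideal_rmul: "p \<in> G \<Longrightarrow> f \<in> I \<Longrightarrow> rmul p f \<in> I"
  using assms lin_subspace_diff[of I f g] unfolding right_ideal_iff lin_subspace_def by auto

lemma ideal_scaleD: "I \<in> L \<Longrightarrow> (\<lambda>x. c * f x) \<in> I \<Longrightarrow> c \<noteq> 0 \<Longrightarrow> f \<in> I"
  using ideal_scale[of I "\<lambda>x. c * f x" "inverse c"] by (simp flip: mult.assoc)

text \<open>Basis elements are units: \<open>rmul (- p)\<close> undoes \<open>rmul p\<close> up to a
  nonzero scalar.\<close>

lemma ideal_rmulD: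
  assumes "I \<in> L" "p \<in> G" "rmul p f \<in> I" shows "f \<in> I"
proof (rule ideal_scaleD[OF assms(1)])
  show "(\<lambda>x. \<beta> p (- p) * f x) \<in> I"
    using ideal_rmul[OF assms(1) _ assms(3), of "- p"] assms(2) by (simp add: rmul_rmul)
qed simp

lemma C_in_L: "C \<in> L"
  by (simp add: right_ideal_iff C_subspace rmul_in_C)

section \<open>Leading exponents\<close>

definition cone :: "(nat \<Rightarrow> int) set" where
  "cone = {x \<in> G. \<forall>i. 0 \<le> x i}"

definition deg :: "(nat \<Rightarrow> int) \<Rightarrow> int" where
  "deg x = (\<Sum>i<n. x i)"

text \<open>The graded lexicographic order: translation invariant, with only finitely many points of
  \<open>cone\<close> below a given one.\<close>

definition lt :: "(nat \<Rightarrow> int) \<Rightarrow> (nat \<Rightarrow> int) \<Rightarrow> bool" where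
  "lt x y \<longleftrightarrow> deg x < deg y \<or> deg x = deg y \<and> less_fun x y"

lemma deg_add: "deg (x + y) = deg x + deg y"
  by (simp add: deg_def sum.distrib)

lemma lt_irrefl: "\<not> lt x x"
  by (simp add: lt_def less_fun_irrefl)

lemma lt_trans: "lt x y \<Longrightarrow> lt y z \<Longrightarrow> lt x z"
  using less_fun_trans[of x y z] by (auto simp: lt_def)

lemma lt_total:
  assumes "x \<in> G" "y \<in> G" "x \<noteq> y" shows "lt x y \<or> lt y x"
proof -
  have "{k. x k \<noteq> y k} \<subseteq> {..<n}" using assms by (force simp: Zn_def)
  then have "finite {k. x k \<noteq> y k}" using finite_subset by blast
  then have "less_fun x y \<or> x = y \<or> less_fun y x" by (rule less_fun_trichotomy)
  then show ?thesis using assms(3) by (auto simp: lt_def)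
qed

lemma lt_add: "lt x y \<Longrightarrow> lt (x + p) (y + p)"
  by (auto simp: lt_def deg_add less_fun_def)

lemma lt_deg: "lt x y \<Longrightarrow> deg x \<le> deg y"
  by (auto simp: lt_def)

lemma cone_add: "x \<in> cone \<Longrightarrow> y \<in> cone \<Longrightarrow> x + y \<in> cone"
  by (auto simp: cone_def)

lemma cone_coord_le_deg: "x \<in> cone \<Longrightarrow> i < n \<Longrightarrow> x i \<le> deg x"
  unfolding deg_def by (rule member_le_sum) (auto simp: cone_def)

lemma finite_cone_deg: "finite {x \<in> cone. deg x \<le> N}"
proof (rule finite_subset)
  show "{x \<in> cone. deg x \<le> N} \<subseteq>
      {x. \<forall>i. (i \<in> {..<n} \<longrightarrow> x i \<in> {0..N}) \<and> (i \<notin> {..<n} \<longrightarrow> x i = 0)}"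
  proof (clarify, intro conjI impI)
    fix x i assume x: "x \<in> cone" "deg x \<le> N"
    show "x i \<in> {0..N}" if "i \<in> {..<n}"
      using x that cone_coord_le_deg[OF x(1), of i] by (simp add: cone_def)
    show "x i = 0" if "i \<notin> {..<n}" using x(1) that by (simp add: cone_def Zn_def)
  qed
  show "finite {x :: nat \<Rightarrow> int. \<forall>i. (i \<in> {..<n} \<longrightarrow> x i \<in> {0..N}) \<and> (i \<notin> {..<n} \<longrightarrow> x i = 0)}"
    by (rule finite_set_of_finite_funs) auto
qed

text \<open>Supplies the measure for induction on leading exponents in division.\<close>

lemma card_below_less:
  assumes "lt e' e" "e' \<in> cone"
  shows "card {y \<in> cone. lt y e'} < card {y \<in> cone. lt y e}"
proof (rule psubset_card_mono)
  have "{y \<in> cone. lt y e} \<subseteq> {y \<in> cone. deg y \<le> deg e}" using lt_deg by auto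
  then show "finite {y \<in> cone. lt y e}" using finite_cone_deg finite_subset by blast
  show "{y \<in> cone. lt y e'} \<subset> {y \<in> cone. lt y e}" using assms lt_trans lt_irrefl by blast
qed

definition lead :: "((nat \<Rightarrow> int) \<Rightarrow> 'a) \<Rightarrow> (nat \<Rightarrow> int) \<Rightarrow> bool" where
  "lead f e \<longleftrightarrow> f e \<noteq> 0 \<and> (\<forall>x. f x \<noteq> 0 \<longrightarrow> x = e \<or> lt x e)"

definition pos :: "((nat \<Rightarrow> int) \<Rightarrow> 'a) \<Rightarrow> bool" where
  "pos f \<longleftrightarrow> (\<forall>x. f x \<noteq> 0 \<longrightarrow> x \<in> cone)"

lemma finite_has_lt_max:
  assumes "finite S" "S \<noteq> {}" "S \<subseteq> G"
  shows "\<exists>e\<in>S. \<forall>x\<in>S. x = e \<or> lt x e"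
  using assms
proof (induction S rule: finite_ne_induct)
  case (insert a S)
  then obtain e where e: "e \<in> S" "\<forall>x\<in>S. x = e \<or> lt x e" by auto
  show ?case
  proof (cases "lt a e")
    case True
    then show ?thesis using e by (intro bexI[of _ e]) auto
  next
    case False
    then have "lt e a" using lt_total[of a e] insert e(1) by auto
    then show ?thesis using e lt_trans[of _ e a] by (intro bexI[of _ a]) auto
  qed
qed auto

lemma lead_exists:
  assumes "f \<in> C" "f \<noteq> 0" shows "\<exists>e. lead f e"
proof -
  have "{x. f x \<noteq> 0} \<noteq> {}" using assms(2) by (auto simp: fun_eq_iff)
  then show ?thesis
    using finite_has_lt_max[of "{x. f x \<noteq> 0}"] assms(1) unfolding lead_def tga_carrier_def by blast
qed

lemma lead_rmul:
  assumes "lead f e" shows "lead (rmul p f) (e + p)"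
  unfolding lead_def
proof (intro conjI allI impI)
  show "rmul p f (e + p) \<noteq> 0" using assms by (simp add: rmul_def lead_def)
  fix x assume "rmul p f x \<noteq> 0"
  then have "x - p = e \<or> lt (x - p) e" using assms by (auto simp: rmul_def lead_def)
  then show "x = e + p \<or> lt x (e + p)" using lt_add[of "x - p" e p] by auto
qed

lemma pos_rmul: "pos f \<Longrightarrow> p \<in> cone \<Longrightarrow> pos (rmul p f)"
  unfolding pos_def rmul_def using cone_add[of _ p] by (metis diff_add_cancel mult_zero_left)

text \<open>Without the restriction to elements supported in \<open>cone\<close>, exponents could be
  shifted by units and every nonzero right ideal would yield all of \<open>G\<close>.\<close>

definition lexp :: "((nat \<Rightarrow> int) \<Rightarrow> 'a) set \<Rightarrow> (nat \<Rightarrow> int) set" where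
  "lexp I = {e. \<exists>f\<in>I. pos f \<and> lead f e}"

lemma lexp_mono: "I \<subseteq> J \<Longrightarrow> lexp I \<subseteq> lexp J"
  by (auto simp: lexp_def)

lemma lexp_cone: "lexp I \<subseteq> cone"
  by (auto simp: lexp_def pos_def lead_def)

lemma lexp_up: "I \<in> L \<Longrightarrow> e \<in> lexp I \<Longrightarrow> p \<in> cone \<Longrightarrow> e + p \<in> lexp I"
proof -
  assume I: "I \<in> L" and e: "e \<in> lexp I" and p: "p \<in> cone"
  obtain f where "f \<in> I" "pos f" "lead f e" using e by (auto simp: lexp_def)
  then show ?thesis unfolding lexp_def
    using lead_rmul[of f e p] pos_rmul[of f p] ideal_rmul[OF I, of p f] p by (auto simp: cone_def)
qed

text \<open>Division with remainder; a degree-compatible order is needed for the bound by \<open>N\<close>.\<close>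

lemma lexp_diff_spans:
  assumes I: "I \<in> L" and J: "J \<in> L" and IJ: "I \<subseteq> J"
    and g: "\<And>e. e \<in> lexp J - lexp I \<Longrightarrow> g e \<in> J \<and> pos (g e) \<and> lead (g e) e"
    and f: "f \<in> J" "pos f" "\<And>x. f x \<noteq> 0 \<Longrightarrow> deg x \<le> N"
  shows "\<exists>\<mu>. f - lincomb {e \<in> lexp J - lexp I. deg e \<le> N} \<mu> g \<in> I"
proof -
  let ?D = "{e \<in> lexp J - lexp I. deg e \<le> N}"
  have finD: "finite ?D" by (rule finite_subset[OF _ finite_cone_deg[of N]]) (use lexp_cone in auto)
  have zero: "\<exists>\<mu>. 0 - lincomb ?D \<mu> g \<in> I"
    by (rule exI[of _ "\<lambda>_. 0"]) (use ideal_0[OF I] in \<open>simp add: lincomb_def zero_fun_def fun_diff_def\<close>)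
  have "\<exists>\<mu>. f - lincomb ?D \<mu> g \<in> I"
    if "lead f e" "f \<in> J" "pos f" "\<And>x. f x \<noteq> 0 \<Longrightarrow> deg x \<le> N" for f e
    using that
  proof (induction "card {y \<in> cone. lt y e}" arbitrary: e f rule: less_induct)
    case (less e f)
    have deg_e: "deg e \<le> N" using less.prems by (auto simp: lead_def)
    \<comment> \<open>Cancelling the leading term of \<open>f\<close> against \<open>h\<close>,
      which has the same leading exponent, lowers the leading exponent and keeps degrees at most
      \<open>N\<close>. The induction hypothesis then covers the remainder unless it is
      zero.\<close>
    have step: "\<exists>\<mu>. (f - (\<lambda>x. f e / h e * h x)) - lincomb ?D \<mu> g \<in> I"
      if h: "h \<in> J" "pos h" "lead h e" for h
    proof -
      let ?f = "f - (\<lambda>x. f e / h e * h x)"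
      have fJ: "?f \<in> J" using ideal_diff[OF J less.prems(2) ideal_scale[OF J h(1)]] .
      have supp: "f x \<noteq> 0 \<or> h x \<noteq> 0" if "?f x \<noteq> 0" for x using that by auto
      have pos: "pos ?f" using supp less.prems(3) h(2) unfolding pos_def by blast
      have degN: "deg x \<le> N" if "?f x \<noteq> 0" for x
        using supp[OF that] less.prems(4)[of x] h(3) lt_deg[of x e] deg_e by (auto simp: lead_def)
      show ?thesis
      proof (cases "?f = 0")
        case True
        then show ?thesis using zero by simp
      next
        case False
        then obtain e' where e': "lead ?f e'" using lead_exists ideal_C[OF J fJ] by blast
        have "?f e = 0" using h(3) by (simp add: lead_def)
        then have "e' \<noteq> e" using e' by (auto simp: lead_def)
        moreover have "f e' \<noteq> 0 \<or> h e' \<noteq> 0" using supp[of e'] e' unfolding lead_def by blast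
        ultimately have "lt e' e" using less.prems(1) h(3) unfolding lead_def by blast
        moreover have "e' \<in> cone" using e' pos by (auto simp: lead_def pos_def)
        ultimately show ?thesis using less.hyps[OF card_below_less e' fJ pos degN] by blast
      qed
    qed
    show ?case
    proof (cases "e \<in> lexp I")
      case True
      \<comment> \<open>Here the subtracted multiple of \<open>h\<close> lies in \<open>I\<close>;
        in the other case the multiple of \<open>g e\<close> is absorbed into the coefficient at
        \<open>e\<close>.\<close>
      then obtain h where h: "h \<in> I" "pos h" "lead h e" by (auto simp: lexp_def)
      then obtain \<mu> where \<mu>: "(f - (\<lambda>x. f e / h e * h x)) - lincomb ?D \<mu> g \<in> I" using step IJ by blast
      have "((f - (\<lambda>x. f e / h e * h x)) - lincomb ?D \<mu> g) + (\<lambda>x. f e / h e * h x) \<in> I"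
        by (rule ideal_add[OF I \<mu> ideal_scale[OF I h(1)]])
      also have "((f - (\<lambda>x. f e / h e * h x)) - lincomb ?D \<mu> g) + (\<lambda>x. f e / h e * h x)
         = f - lincomb ?D \<mu> g" by (simp add: fun_eq_iff)
      finally show ?thesis by blast
    next
      case False
      then have eD: "e \<in> lexp J - lexp I" using less.prems by (auto simp: lexp_def)
      then have eD': "e \<in> ?D" using deg_e by simp
      obtain \<mu> where \<mu>: "(f - (\<lambda>x. f e / g e e * g e x)) - lincomb ?D \<mu> g \<in> I"
        using step g[OF eD] by blast
      have "lincomb ?D (\<mu>(e := \<mu> e + f e / g e e)) g
          = (\<lambda>x. f e / g e e * g e x) + lincomb ?D \<mu> g"
        using finD eD' by (rule lincomb_fun_upd)
      then have "(f - (\<lambda>x. f e / g e e * g e x)) - lincomb ?D \<mu> g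
          = f - lincomb ?D (\<mu>(e := \<mu> e + f e / g e e)) g" by (simp add: fun_eq_iff)
      then show ?thesis using \<mu> by metis
    qed
  qed
  then show ?thesis using f zero lead_exists[OF ideal_C[OF J f(1)]] by (cases "f = 0") blast+
qed

end


section \<open>Differences of order ideals of exponents\<close>

text \<open>Beyond every bound there is an index at which the sequence attains the minimum of its
  tail; following such indices gives a nondecreasing subsequence.\<close>

lemma nat_seq_mono_subseq:
  fixes g :: "nat \<Rightarrow> int"
  assumes "\<And>k. 0 \<le> g k"
  shows "\<exists>r. strict_mono (r :: nat \<Rightarrow> nat) \<and> (\<forall>j k. j \<le> k \<longrightarrow> g (r j) \<le> g (r k))"
proof -
  have ex: "\<exists>x\<ge>m. \<forall>y\<ge>x. g x \<le> g y" for m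
  proof -
    obtain x where x: "m \<le> x" "\<And>y. m \<le> y \<Longrightarrow> nat (g x) \<le> nat (g y)"
      using ex_has_least_nat[of "\<lambda>x. m \<le> x" m "\<lambda>x. nat (g x)"] by auto
    have "g x \<le> g y" if "x \<le> y" for y using x(1) x(2)[of y] that assms by (simp add: nat_le_eq_zle)
    then show ?thesis using x(1) by blast
  qed
  have "\<exists>r. \<forall>k. (\<forall>y\<ge>r k. g (r k) \<le> g y) \<and> r k < r (Suc k)"
  proof (rule dependent_nat_choice)
    show "\<exists>x. \<forall>y\<ge>x. g x \<le> g y" using ex[of 0] by auto
    show "\<exists>y. (\<forall>z\<ge>y. g y \<le> g z) \<and> x < y" for x :: nat using ex[of "Suc x"] by auto
  qed
  then obtain r where r: "\<And>k y. r k \<le> y \<Longrightarrow> g (r k) \<le> g y" "\<And>k. r k < r (Suc k)" by blast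
  have "strict_mono r" using r(2) by (simp add: strict_mono_Suc_iff)
  moreover have "g (r j) \<le> g (r k)" if "j \<le> k" for j k
    using r(1)[of j "r k"] \<open>strict_mono r\<close> that by (simp add: strict_mono_less_eq)
  ultimately show ?thesis by blast
qed

lemma mono_subseq_coordinates:
  fixes f :: "nat \<Rightarrow> nat \<Rightarrow> int"
  assumes "\<And>k i. 0 \<le> f k i"
  shows "\<exists>r. strict_mono (r :: nat \<Rightarrow> nat) \<and> (\<forall>i<m. \<forall>j k. j \<le> k \<longrightarrow> f (r j) i \<le> f (r k) i)"
proof (induction m)
  case 0
  show ?case by (rule exI[of _ id]) (simp add: strict_mono_def)
next
  case (Suc m)
  then obtain r :: "nat \<Rightarrow> nat" where r: "strict_mono r" "\<forall>i<m. \<forall>j k. j \<le> k \<longrightarrow> f (r j) i \<le> f (r k) i" by blast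
  obtain r' :: "nat \<Rightarrow> nat" where r': "strict_mono r'"
    "\<forall>j k. j \<le> k \<longrightarrow> f (r (r' j)) m \<le> f (r (r' k)) m"
    using nat_seq_mono_subseq[of "\<lambda>k. f (r k) m"] assms by blast
  have "strict_mono (\<lambda>k. r (r' k))" using r(1) r'(1) by (simp add: strict_mono_def)
  moreover have "f (r (r' j)) i \<le> f (r (r' k)) i" if "i < Suc m" "j \<le> k" for i j k
    using that r(2) r' by (cases "i = m") (auto simp: strict_mono_less_eq)
  ultimately show ?case by blast
qed

context bichar_torus
begin

definition up :: "(nat \<Rightarrow> int) set \<Rightarrow> bool" where
  "up E \<longleftrightarrow> E \<subseteq> cone \<and> (\<forall>e\<in>E. \<forall>p\<in>cone. e + p \<in> E)"

lemma up_lexp: "I \<in> L \<Longrightarrow> up (lexp I)"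
  using lexp_cone lexp_up by (auto simp: up_def)

lemma up_le:
  assumes "up E" "e \<in> E" "y \<in> cone" "\<And>i. i < n \<Longrightarrow> e i \<le> y i" shows "y \<in> E"
proof -
  have "0 \<le> (y - e) i" for i
    using assms(4)[of i] assms(1-3) by (cases "i < n") (auto simp: up_def cone_def Zn_def subset_iff)
  then have "y - e \<in> cone" using assms(1-3) by (auto simp: up_def cone_def subset_iff)
  then have "e + (y - e) \<in> E" using assms(1,2) unfolding up_def by blast
  then show ?thesis by simp
qed

definition trunc :: "int \<Rightarrow> (nat \<Rightarrow> int) \<Rightarrow> nat \<Rightarrow> int" where
  "trunc M x = (\<lambda>i. min (x i) M)"

lemma trunc_cone: "0 \<le> M \<Longrightarrow> x \<in> cone \<Longrightarrow> trunc M x \<in> cone"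
  by (auto simp: trunc_def cone_def Zn_def)

text \<open>Dickson's lemma: any bound on the coordinates of the minimal elements of \<open>E\<close> serves as \<open>M\<close>.\<close>

lemma up_truncation:
  assumes "up E"
  shows "\<exists>M::nat. \<forall>M'\<ge>M. \<forall>x\<in>E. trunc (int M') x \<in> E"
proof (rule ccontr)
  assume "\<not> ?thesis"
  then have "\<forall>M::nat. \<exists>M' x. M \<le> M' \<and> x \<in> E \<and> trunc (int M') x \<notin> E" by blast
  then obtain F x where x: "\<And>M::nat. M \<le> F M \<and> x M \<in> E \<and> trunc (int (F M)) (x M) \<notin> E"
    by metis
  have xc: "x M \<in> cone" for M using x assms by (auto simp: up_def)
  obtain r :: "nat \<Rightarrow> nat" where r: "strict_mono r"
    "\<And>i j k. i < n \<Longrightarrow> j \<le> k \<Longrightarrow> x (r j) i \<le> x (r k) i"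
    using mono_subseq_coordinates[of x n] xc by (auto simp: cone_def)
  \<comment> \<open>Every \<open>x (r k)\<close> dominates \<open>y\<close>, whose coordinates are
    at most \<open>M\<close>. At index \<open>r M\<close> the cutoff \<open>F (r M)\<close> is at
    least \<open>M\<close>, so the truncated point still dominates \<open>y\<close> and must lie in
    \<open>E\<close>.\<close>
  define y where "y = x (r 0)"
  define M where "M = nat (deg y)"
  have le: "y i \<le> int M" if "i < n" for i
    using cone_coord_le_deg[of y i] xc that by (simp add: y_def M_def)
  let ?k = "r M"
  have FM: "M \<le> F ?k" using x[of ?k] strict_mono_imp_increasing[OF r(1), of M] by linarith
  have "trunc (int (F ?k)) (x ?k) \<in> E"
  proof (rule up_le[OF assms])
    show "y \<in> E" using x y_def by simp
    show "trunc (int (F ?k)) (x ?k) \<in> cone" using trunc_cone xc by simp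
    show "y i \<le> trunc (int (F ?k)) (x ?k) i" if "i < n" for i
      using le[OF that] r(2)[OF that, of 0 M] FM by (simp add: trunc_def y_def)
  qed
  then show False using x by blast
qed

text \<open>Such a set is a finite union of orthants, one for each of its points in the box of side
  \<open>M\<close>.\<close>

definition determined :: "int \<Rightarrow> (nat \<Rightarrow> int) set \<Rightarrow> bool" where
  "determined M D \<longleftrightarrow> 0 \<le> M \<and> D \<subseteq> cone \<and> (\<forall>x\<in>cone. x \<in> D \<longleftrightarrow> trunc M x \<in> D)"

text \<open>Truncation only lowers coordinates, so upward closure gives one direction and Dickson's
  lemma the other; a common cutoff serves both sets.\<close>

lemma up_diff_determined:
  assumes "up E" "up E'" shows "\<exists>M. determined M (E - E')"
proof -
  obtain M M' :: nat where M: "\<forall>N\<ge>M. \<forall>x\<in>E. trunc (int N) x \<in> E" "\<forall>N\<ge>M'. \<forall>x\<in>E'. trunc (int N) x \<in> E'"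
    using up_truncation assms by metis
  let ?N = "int (max M M')"
  have down: "x \<in> H" if "up H" "trunc ?N x \<in> H" "x \<in> cone" for H x
    by (rule up_le[OF that]) (simp add: trunc_def)
  have "\<forall>x\<in>E. trunc ?N x \<in> E" "\<forall>x\<in>E'. trunc ?N x \<in> E'"
    using M by (meson max.cobounded1 max.cobounded2)+
  then have "x \<in> E - E' \<longleftrightarrow> trunc ?N x \<in> E - E'" if "x \<in> cone" for x
    using down[OF assms(1) _ that] down[OF assms(2) _ that] by blast
  moreover have "E - E' \<subseteq> cone" using assms(1) unfolding up_def by blast
  ultimately have "determined ?N (E - E')" unfolding determined_def by simp
  then show ?thesis by blast
qed

section \<open>Orthants and growth dimension\<close>

definition orth :: "(nat \<Rightarrow> int) \<Rightarrow> nat set \<Rightarrow> (nat \<Rightarrow> int) set" where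
  "orth x S = {y \<in> cone. \<forall>i<n. (i \<in> S \<longrightarrow> x i \<le> y i) \<and> (i \<notin> S \<longrightarrow> y i = x i)}"

text \<open>The bound is strict so that level \<open>0\<close> makes sense: single points are
  orthants with \<open>S\<close> empty, hence \<open>dimlt D 0\<close> excludes every point of
  \<open>cone\<close>.\<close>

definition dimlt :: "(nat \<Rightarrow> int) set \<Rightarrow> nat \<Rightarrow> bool" where
  "dimlt D d \<longleftrightarrow> (\<forall>x\<in>cone. \<forall>S\<subseteq>{..<n}. orth x S \<subseteq> D \<longrightarrow> card S < d)"

lemma dimlt_Suc_n: "dimlt D (Suc n)"
  unfolding dimlt_def using card_mono[of "{..<n}"] by (auto simp: less_Suc_eq_le)

text \<open>The directions in which truncation at \<open>M\<close> loses information, that is, the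
  free directions of the piece that truncates to \<open>c\<close>.\<close>

definition saturated :: "int \<Rightarrow> (nat \<Rightarrow> int) \<Rightarrow> nat set" where
  "saturated M c = {i. i < n \<and> c i = M}"

lemma finite_box: "finite {x \<in> cone. \<forall>i. x i \<le> M}"
proof (rule finite_subset[OF _ finite_cone_deg])
  show "{x \<in> cone. \<forall>i. x i \<le> M} \<subseteq> {x \<in> cone. deg x \<le> of_nat (card {..<n}) * M}"
    unfolding deg_def by (clarify, rule sum_bounded_above) simp
qed

lemma orth_saturated:
  assumes "determined M D" "c \<in> D" "\<forall>i. c i \<le> M"
  shows "orth c (saturated M c) \<subseteq> D"
proof
  fix y assume y: "y \<in> orth c (saturated M c)"
  have "trunc M y i = c i" for i
  proof (cases "i < n")
    case True
    then show ?thesis using y assms(3) by (cases "c i = M") (auto simp: orth_def saturated_def trunc_def)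
  next
    case False
    have "c \<in> cone" "y \<in> cone" using y assms(1,2) unfolding determined_def orth_def by blast+
    then have "y i = 0" "c i = 0" using False by (simp_all add: cone_def Zn_def)
    then show ?thesis using assms(1) by (simp add: trunc_def determined_def)
  qed
  then have "trunc M y = c" by blast
  then show "y \<in> D" using assms(1,2) y unfolding determined_def orth_def by blast
qed

text \<open>\<open>D\<close> splits by truncation into finitely many pieces. A point of a piece is
  given by its saturated coordinates, fewer than \<open>d\<close> of them and each between
  \<open>0\<close> and \<open>N\<close>. The factor \<open>N + 1\<close> on the left expresses
  growth of order \<open>d - 1\<close> without subtraction and covers \<open>d = 0\<close>.\<close>

lemma dimlt_growth:
  assumes D: "determined M D" and dim: "dimlt D d"
  shows "\<exists>K. \<forall>N::nat. card {x \<in> D. deg x \<le> int N} * (N + 1) \<le> K * (N + 1) ^ d"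
proof -
  let ?B = "{c \<in> D. \<forall>i. c i \<le> M}"
  have Dc: "D \<subseteq> cone" and M0: "0 \<le> M" using D by (auto simp: determined_def)
  have finB: "finite ?B" by (rule finite_subset[OF _ finite_box[of M]]) (use Dc in auto)
  have "card {x \<in> D. deg x \<le> int N} * (N + 1) \<le> card ?B * (N + 1) ^ d" for N :: nat
  proof -
    define X where "X c = {x \<in> cone. deg x \<le> int N \<and> trunc M x = c}" for c
    have finX: "finite (X c)" for c
      by (rule finite_subset[OF _ finite_cone_deg[of "int N"]]) (auto simp: X_def)
    have cardX: "card (X c) * (N + 1) \<le> (N + 1) ^ d" if c: "c \<in> ?B" for c
    proof -
      let ?S = "saturated M c"
      have finS: "finite ?S" by (simp add: saturated_def)
      \<comment> \<open>Outside the saturated directions the coordinates lie below the cutoff and so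
        equal those of \<open>c\<close>.\<close>
      have inj: "inj_on (\<lambda>x. restrict x ?S) (X c)"
      proof (rule inj_onI)
        fix x y assume x: "x \<in> X c" and y: "y \<in> X c" and eq: "restrict x ?S = restrict y ?S"
        show "x = y"
        proof
          fix i
          have "trunc M x = c" "trunc M y = c" using x y by (auto simp: X_def)
          then have t: "min (x i) M = c i" "min (y i) M = c i" unfolding trunc_def by meson+
          have G: "x \<in> G" "y \<in> G" using x y by (auto simp: X_def cone_def)
          show "x i = y i"
          proof (cases "i \<in> ?S")
            case True
            then show ?thesis using fun_cong[OF eq, of i] by simp
          next
            case False
            then show ?thesis using t G by (cases "i < n") (auto simp: saturated_def Zn_def min_def split: if_splits)
          qed
        qed
      qed
      have "(\<lambda>x. restrict x ?S) ` X c \<subseteq> PiE ?S (\<lambda>_. {0..int N})"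
      proof (rule image_subsetI)
        fix x assume x: "x \<in> X c"
        have "x i \<in> {0..int N}" if "i \<in> ?S" for i
          using x that cone_coord_le_deg[of x i] by (auto simp: X_def saturated_def cone_def)
        then show "restrict x ?S \<in> PiE ?S (\<lambda>_. {0..int N})" by auto
      qed
      then have "card ((\<lambda>x. restrict x ?S) ` X c) \<le> card (PiE ?S (\<lambda>_. {0..int N}))"
        using finS by (intro card_mono finite_PiE) auto
      then have "card (X c) \<le> (N + 1) ^ card ?S"
        using finS by (simp add: card_image[OF inj] card_PiE nat_add_distrib)
      moreover have "card ?S < d"
        using dim[unfolded dimlt_def, rule_format, OF _ _ orth_saturated[OF D, of c]] c Dc
        by (auto simp: saturated_def)
      then have "(N + 1) ^ Suc (card ?S) \<le> (N + 1) ^ d"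
        by (intro power_increasing) auto
      ultimately show ?thesis by (simp add: mult.commute) (meson le_trans add_mono mult_le_mono2)
    qed
    have "{x \<in> D. deg x \<le> int N} \<subseteq> (\<Union>c\<in>?B. X c)"
    proof
      fix x assume x: "x \<in> {x \<in> D. deg x \<le> int N}"
      then have "trunc M x \<in> ?B" using D by (auto simp: determined_def trunc_def)
      then show "x \<in> (\<Union>c\<in>?B. X c)" using x Dc by (auto simp: X_def)
    qed
    then have "card {x \<in> D. deg x \<le> int N} \<le> card (\<Union>c\<in>?B. X c)"
      using finX finB by (intro card_mono) auto
    also have "\<dots> \<le> (\<Sum>c\<in>?B. card (X c))" using finB by (rule card_UN_le)
    finally have "card {x \<in> D. deg x \<le> int N} * (N + 1) \<le> (\<Sum>c\<in>?B. card (X c) * (N + 1))"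
      by (simp only: sum_distrib_right[symmetric] mult_le_mono1)
    also have "\<dots> \<le> (\<Sum>c\<in>?B. (N + 1) ^ d)" using cardX by (rule sum_mono)
    finally show ?thesis by simp
  qed
  then show ?thesis by blast
qed

text \<open>Each piece containing an orthant of dimension at least \<open>d\<close> is assigned a
  point \<open>c i\<close> of the finite box of side \<open>M\<close>. Two pieces with the same
  point would contain orthants that meet, so disjointness leaves finitely many such pieces.\<close>

lemma dimlt_disjoint_pieces:
  fixes P :: "nat \<Rightarrow> (nat \<Rightarrow> int) set"
  assumes D: "determined M D" and dim: "dimlt D (Suc d)"
    and sub: "\<And>i. P i \<subseteq> D" and disj: "\<And>i j. i \<noteq> j \<Longrightarrow> P i \<inter> P j = {}"
  shows "\<exists>N. \<forall>i\<ge>N. dimlt (P i) d"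
proof -
  have Dc: "D \<subseteq> cone" and M0: "0 \<le> M" using D by (auto simp: determined_def)
  let ?Bad = "{i. \<not> dimlt (P i) d}"
  have "\<forall>i\<in>?Bad. \<exists>x S. x \<in> cone \<and> S \<subseteq> {..<n} \<and> orth x S \<subseteq> P i \<and> d \<le> card S"
    unfolding dimlt_def by (auto simp: not_less)
  then obtain x S where xS: "\<And>i. i \<in> ?Bad \<Longrightarrow>
      x i \<in> cone \<and> S i \<subseteq> {..<n} \<and> orth (x i) (S i) \<subseteq> P i \<and> d \<le> card (S i)"
    by metis
  \<comment> \<open>Moving the base point past \<open>M\<close> along its orthant makes these
    directions saturated in \<open>c i\<close>.\<close>
  define X where "X i = (\<lambda>k. if k \<in> S i then max (x i k) M else x i k)" for i
  define c where "c i = trunc M (X i)" for i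
  have Xc: "X i \<in> cone" if "i \<in> ?Bad" for i
    using xS[OF that] by (auto simp: X_def cone_def Zn_def subset_iff le_max_iff_disj)
  have cD: "c i \<in> D" "\<forall>k. c i k \<le> M" "c i \<in> cone" if i: "i \<in> ?Bad" for i
  proof -
    have "X i \<in> orth (x i) (S i)" using Xc[OF i] by (auto simp: orth_def X_def)
    then show "c i \<in> D" using xS[OF i] sub D Xc[OF i] unfolding c_def determined_def by blast
    then show "c i \<in> cone" using Dc by blast
  qed (simp add: c_def trunc_def)
  \<comment> \<open>\<open>S i\<close> has at least \<open>d\<close> elements, while the orthant at
    \<open>c i\<close> in its saturated directions lies in \<open>D\<close> and has dimension at
    most \<open>d\<close>.\<close>
  have Seq: "S i = saturated M (c i)" if i: "i \<in> ?Bad" for i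
  proof (rule card_seteq)
    show "finite (saturated M (c i))" by (simp add: saturated_def)
    show "S i \<subseteq> saturated M (c i)"
      using xS[OF i] by (auto simp: saturated_def c_def trunc_def X_def)
    have "card (saturated M (c i)) < Suc d"
      using dim[unfolded dimlt_def, rule_format, OF cD(3)[OF i] _ orth_saturated[OF D cD(1,2)[OF i]]]
      by (auto simp: saturated_def)
    then show "card (saturated M (c i)) \<le> card (S i)" using xS[OF i] by simp
  qed
  have "inj_on c ?Bad"
  proof (rule inj_onI, rule ccontr)
    fix i j assume i: "i \<in> ?Bad" and j: "j \<in> ?Bad" and eq: "c i = c j" and "i \<noteq> j"
    \<comment> \<open>The two moved base points agree outside the common directions, so their
      coordinatewise maximum lies in both orthants.\<close>
    define z where "z = (\<lambda>k. max (X i k) (X j k))"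
    have z: "z \<in> cone" using Xc[OF i] Xc[OF j] by (auto simp: z_def cone_def Zn_def le_max_iff_disj)
    have out: "X i k = X j k" if "k < n" "k \<notin> S i" for k
    proof -
      have "c i k \<noteq> M" using that Seq[OF i] by (simp add: saturated_def)
      then show ?thesis using fun_cong[OF eq, of k]
        by (auto simp: c_def trunc_def min_def split: if_splits)
    qed
    have SS: "S i = S j" using Seq[OF i] Seq[OF j] eq by simp
    have "z \<in> orth (x i) (S i)" using z out by (auto simp: orth_def z_def X_def SS)
    moreover have "z \<in> orth (x j) (S j)"
      using z out by (auto simp: orth_def z_def X_def SS)
    ultimately show False using xS[OF i] xS[OF j] disj[OF \<open>i \<noteq> j\<close>] by blast
  qed
  moreover have "finite (c ` ?Bad)"
    by (rule finite_subset[OF _ finite_box[of M]]) (use cD in auto)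
  ultimately have "finite ?Bad" using finite_imageD by blast
  then obtain N where "\<forall>i\<in>?Bad. i < N" using finite_nat_set_iff_bounded by blast
  then show ?thesis by (intro exI[of _ N]) auto
qed

text \<open>Along a descending chain the differences of exponent sets are disjoint parts of
  \<open>lexp J - lexp I\<close>, so almost all factors have smaller growth dimension and the
  induction hypothesis applies. At \<open>k = 0\<close> the dimension is below the minimum
  \<open>m\<close>, which forces \<open>I = J\<close>.\<close>

lemma dev_less_of_min_dim:
  assumes min: "\<And>I J. I \<in> L \<Longrightarrow> J \<in> L \<Longrightarrow> I \<subset> J \<Longrightarrow> \<not> dimlt (lexp J - lexp I) m"
    and "I \<in> L" "J \<in> L" "I \<subseteq> J" "dimlt (lexp J - lexp I) (m + k)"
  shows "dev_less k {x \<in> L. I \<subseteq> x \<and> x \<subseteq> J}"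
  using assms(2-)
proof (induction k arbitrary: I J)
  case 0
  then have "I = J" using min[of I J] by (auto simp: psubset_eq)
  then have "x = I" if "x \<in> {x \<in> L. I \<subseteq> x \<and> x \<subseteq> J}" for x using that by blast
  then have "\<forall>x\<in>{x \<in> L. I \<subseteq> x \<and> x \<subseteq> J}. \<forall>y\<in>{x \<in> L. I \<subseteq> x \<and> x \<subseteq> J}. x \<subseteq> y \<longrightarrow> x = y"
    by blast
  then have "dev_less 0 {x \<in> L. I \<subseteq> x \<and> x \<subseteq> J}" by (simp only: dev_less.simps(1))
  then show ?case .
next
  case (Suc k)
  show ?case
    unfolding dev_less.simps(2)
  proof (intro allI impI)
    fix a :: "nat \<Rightarrow> ((nat \<Rightarrow> int) \<Rightarrow> 'a) set"
    assume a: "\<forall>i. a i \<in> {x \<in> L. I \<subseteq> x \<and> x \<subseteq> J} \<and> a (Suc i) \<subseteq> a i"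
    define P where "P i = lexp (a i) - lexp (a (Suc i))" for i
    have anti: "a j \<subseteq> a i" if "i \<le> j" for i j
      using that a lift_Suc_antimono_le[of a i j] by blast
    have disj': "P i \<inter> P j = {}" if "i < j" for i j
      using lexp_mono[OF anti[of "Suc i" j]] that by (auto simp: P_def)
    have disj: "P i \<inter> P j = {}" if "i \<noteq> j" for i j
      using disj'[of i j] disj'[of j i] that by (cases i j rule: linorder_cases) auto
    obtain M where M: "determined M (lexp J - lexp I)"
      using up_diff_determined up_lexp Suc.prems by blast
    have sub: "P i \<subseteq> lexp J - lexp I" for i
      using a lexp_mono[of "a i" J] lexp_mono[of I "a (Suc i)"] by (auto simp: P_def)
    have "dimlt (lexp J - lexp I) (Suc (m + k))" using Suc.prems(4) by simp
    then obtain N where N: "\<forall>i\<ge>N. dimlt (P i) (m + k)"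
      using dimlt_disjoint_pieces[where P = P, OF M _ sub disj] by blast
    have "dev_less k {x \<in> {x \<in> L. I \<subseteq> x \<and> x \<subseteq> J}. a (Suc i) \<subseteq> x \<and> x \<subseteq> a i}" if "i \<ge> N" for i
    proof (rule dev_less_subset)
      show "dev_less k {x \<in> L. a (Suc i) \<subseteq> x \<and> x \<subseteq> a i}"
      proof (rule Suc.IH)
        show "a (Suc i) \<in> L" "a i \<in> L" "a (Suc i) \<subseteq> a i" using a by blast+
        show "dimlt (lexp (a i) - lexp (a (Suc i))) (m + k)" using N that unfolding P_def by blast
      qed
    qed blast
    then show "\<exists>N. \<forall>i\<ge>N. dev_less k {x \<in> {x \<in> L. I \<subseteq> x \<and> x \<subseteq> J}. a (Suc i) \<subseteq> x \<and> x \<subseteq> a i}"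
      by blast
  qed
qed

end


section \<open>A Bernstein inequality\<close>

definition unit_vec :: "nat \<Rightarrow> nat \<Rightarrow> int" where
  "unit_vec i = (\<lambda>k. if k = i then 1 else 0)"

definition expo_cube :: "nat set \<Rightarrow> nat \<Rightarrow> (nat \<Rightarrow> int) set" where
  "expo_cube T k = (\<lambda>g i. if i \<in> T then g i else 0) ` PiE T (\<lambda>_. {0..<int k})"

lemma expo_cube_card:
  assumes "finite T" shows "finite (expo_cube T k)" "card (expo_cube T k) = k ^ card T"
proof -
  show "finite (expo_cube T k)" using assms by (simp add: expo_cube_def finite_PiE)
  have "inj_on (\<lambda>g i. if i \<in> T then g i else 0 :: int) (PiE T (\<lambda>_. {0..<int k}))"
  proof (rule inj_onI)
    fix g h assume g: "g \<in> PiE T (\<lambda>_. {0..<int k})" and h: "h \<in> PiE T (\<lambda>_. {0..<int k})"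
      and eq: "(\<lambda>i. if i \<in> T then g i else 0 :: int) = (\<lambda>i. if i \<in> T then h i else 0)"
    show "g = h"
    proof (rule PiE_ext[OF g h])
      show "g i = h i" if "i \<in> T" for i using fun_cong[OF eq, of i] that by simp
    qed
  qed
  then show "card (expo_cube T k) = k ^ card T"
    using assms by (simp add: expo_cube_def card_image card_PiE)
qed

lemma expo_cubeD:
  assumes "p \<in> expo_cube T k"
  shows "i \<notin> T \<Longrightarrow> p i = 0" "0 \<le> p i" "i \<in> T \<Longrightarrow> p i < int k" "p i \<le> int k"
proof -
  obtain g where g: "g \<in> PiE T (\<lambda>_. {0..<int k})" "p = (\<lambda>i. if i \<in> T then g i else 0)"
    using assms by (auto simp: expo_cube_def)
  then have "i \<in> T \<Longrightarrow> g i \<in> {0..<int k}" by blast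
  then show "i \<notin> T \<Longrightarrow> p i = 0" "0 \<le> p i" "i \<in> T \<Longrightarrow> p i < int k" "p i \<le> int k"
    using g(2) by auto
qed

text \<open>Growth of \<open>\<delta>\<close> has order at most \<open>m - 1\<close>, so its square
  falls behind \<open>k ^ (2 * m)\<close> for large \<open>k\<close>.\<close>

lemma polynomial_growth_contradiction:
  fixes \<delta> :: "nat \<Rightarrow> nat"
  assumes "\<And>N. \<delta> N * (N + 1) \<le> K * (N + 1) ^ m" "1 \<le> c"
  shows "\<exists>k\<ge>1. \<delta> (c * k) * \<delta> (c * k) < k ^ (2 * m)"
proof -
  \<comment> \<open>Cancelling \<open>k ^ (2 * m)\<close> in the opposite inequality leaves the
    constant \<open>K^2 * (c + 1) ^ (2 * m)\<close>, which this \<open>k\<close> exceeds.\<close>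
  define k where "k = K^2 * (c + 1) ^ (2 * m) + 1"
  let ?N = "c * k"
  have "\<delta> ?N * \<delta> ?N < k ^ (2 * m)"
  proof (rule ccontr)
    assume "\<not> ?thesis"
    then have "k ^ (2 * m) * (?N + 1)^2 \<le> (\<delta> ?N * \<delta> ?N) * (?N + 1)^2"
      by (intro mult_le_mono1) simp
    also have "\<dots> = (\<delta> ?N * (?N + 1))^2" by (simp only: power2_eq_square mult_ac)
    also have "\<dots> \<le> (K * (?N + 1) ^ m)^2" using assms(1) by (rule power_mono) simp
    also have "\<dots> \<le> (K * ((c + 1) * k) ^ m)^2"
      by (intro power_mono mult_mono) (auto simp: k_def)
    also have "\<dots> = k ^ (2 * m) * (K^2 * (c + 1) ^ (2 * m))"
      by (simp only: power_mult_distrib power_mult[symmetric] mult.commute mult.left_commute)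
    finally have "(?N + 1)^2 \<le> K^2 * (c + 1) ^ (2 * m)" by (simp add: k_def)
    moreover have "k \<le> ?N + 1" using assms(2) by (cases c) auto
    then have "k \<le> (?N + 1)^2" by (simp add: power2_eq_square)
    ultimately show False by (simp add: k_def)
  qed
  then show ?thesis by (intro exI[of _ k]) (simp add: k_def)
qed

context bichar_torus
begin

text \<open>The quotient is the commutation factor between the basis elements of
  \<open>unit_vec j\<close> and \<open>p\<close>: some generator detects coordinate \<open>i\<close>
  and nothing else.\<close>

definition separated :: "nat \<Rightarrow> bool" where
  "separated i \<longleftrightarrow> (\<exists>j<n. \<forall>p p'. \<beta> (unit_vec j) p / \<beta> p (unit_vec j)
      = \<beta> (unit_vec j) p' / \<beta> p' (unit_vec j) \<longleftrightarrow> p i = p' i)"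

definition box :: "int \<Rightarrow> nat \<Rightarrow> (nat \<Rightarrow> int) set" where
  "box lo K = {b \<in> G. \<forall>i<n. lo \<le> b i \<and> b i \<le> lo + int K}"

text \<open>Right multiplication by the algebra element with coefficients \<open>\<mu>\<close> on
  \<open>P\<close>.\<close>

definition rmul_comb ::
  "(nat \<Rightarrow> int) set \<Rightarrow> ((nat \<Rightarrow> int) \<Rightarrow> 'a) \<Rightarrow> ((nat \<Rightarrow> int) \<Rightarrow> 'a) \<Rightarrow> (nat \<Rightarrow> int) \<Rightarrow> 'a" where
  "rmul_comb P \<mu> f = lincomb P \<mu> (\<lambda>p. rmul p f)"

lemma rmul_comb_diff: "rmul_comb P \<mu> (f - g) = rmul_comb P \<mu> f - rmul_comb P \<mu> g"
  by (simp add: rmul_comb_def rmul_diff lincomb_def fun_eq_iff algebra_simps sum_subtractf)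

lemma rmul_comb_lincomb: "rmul_comb P \<mu> (lincomb T \<nu> v) = lincomb T \<nu> (\<lambda>t. rmul_comb P \<mu> (v t))"
proof
  fix x
  have "(\<Sum>p\<in>P. \<Sum>t\<in>T. \<mu> p * (\<nu> t * rmul p (v t) x)) = (\<Sum>t\<in>T. \<Sum>p\<in>P. \<mu> p * (\<nu> t * rmul p (v t) x))"
    by (rule sum.swap)
  then show "rmul_comb P \<mu> (lincomb T \<nu> v) x = lincomb T \<nu> (\<lambda>t. rmul_comb P \<mu> (v t)) x"
    unfolding rmul_comb_def rmul_lincomb
    by (simp add: lincomb_def sum_distrib_left mult.left_commute)
qed

lemma rmul_comb_ideal: "I \<in> L \<Longrightarrow> P \<subseteq> G \<Longrightarrow> f \<in> I \<Longrightarrow> rmul_comb P \<mu> f \<in> I"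
  unfolding rmul_comb_def
  by (rule lin_subspace_lincomb) (use ideal_subspace ideal_rmul in blast)+

lemma rmul_conj:
  "rmul p (rmul e f) = (\<lambda>x. \<beta> e p / \<beta> p e * rmul e (rmul p f) x)"
  by (simp add: rmul_rmul fun_eq_iff add.commute)

lemma unit_vec_Zn [simp]: "j < n \<Longrightarrow> unit_vec j \<in> Zn n"
  by (simp add: unit_vec_def Zn_def)

text \<open>Commuting with \<open>x\<^sup>e\<close> multiplies the coefficient at \<open>p\<close> by a power of a scalar of infinite
  order, so one coordinate value can be eliminated at each step until a unit remains.\<close>

lemma separation:
  assumes I: "I \<in> L" and T: "T \<subseteq> {..<n}" "\<And>i. i \<in> T \<Longrightarrow> separated i"
    and "finite P" "P \<noteq> {}" "P \<subseteq> G" "\<And>p i. p \<in> P \<Longrightarrow> i \<notin> T \<Longrightarrow> p i = 0"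
    and "\<And>p. p \<in> P \<Longrightarrow> \<mu> p \<noteq> 0"
    and "\<And>b. b \<in> box lo K \<Longrightarrow> rmul_comb P \<mu> (rmul b f) \<in> I"
    and "(\<Sum>i\<in>T. card ((\<lambda>p. p i) ` P) - 1) \<le> K"
  shows "f \<in> I"
  using assms(4-)
proof (induction K arbitrary: P \<mu>)
  case (0 P \<mu>)
  show ?case
  proof (rule ccontr)
    assume "f \<notin> I"
    have finT: "finite T" using T(1) finite_subset by blast
    obtain p where p: "p \<in> P" using 0 by blast
    \<comment> \<open>The bound \<open>0\<close> allows a single value on \<open>P\<close> for each
      coordinate in \<open>T\<close>, so the element is a multiple of one basis element, hence a
      unit.\<close>
    have "q = p" if q: "q \<in> P" for q
    proof
      fix i
      show "q i = p i"
      proof (cases "i \<in> T")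
        case True
        have "card ((\<lambda>p. p i) ` P) \<le> Suc 0" using 0(7) finT True by auto
        then show ?thesis using p q 0(1) card_le_Suc0_iff_eq[of "(\<lambda>p. p i) ` P"] by auto
      next
        case False
        then show ?thesis using 0(4)[OF p False] 0(4)[OF q False] by simp
      qed
    qed
    then have P: "P = {p}" using p by blast
    define b where "b = (\<lambda>i. if i < n then lo else 0)"
    have bG: "b \<in> G" by (simp add: b_def Zn_def)
    have "b \<in> box lo 0" using bG by (simp add: box_def) (simp add: b_def)
    then have "(\<lambda>x. \<mu> p * rmul p (rmul b f) x) \<in> I"
      using 0(6)[of b] by (simp add: P rmul_comb_def lincomb_def)
    then have "rmul p (rmul b f) \<in> I" using ideal_scaleD[OF I] 0(5) p by blast
    then show False using ideal_rmulD[OF I] bG 0(3) p \<open>f \<notin> I\<close> by blast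
  qed
next
  case (Suc K P \<mu>)
  have finT: "finite T" using T(1) finite_subset by blast
  show ?case
  proof (cases "\<exists>i\<in>T. \<exists>p\<in>P. \<exists>p'\<in>P. p i \<noteq> p' i")
    case False
    have "card ((\<lambda>p. p i) ` P) - 1 = 0" if "i \<in> T" for i
      using False that Suc.prems(1) card_le_Suc0_iff_eq[of "(\<lambda>p. p i) ` P"] by auto
    then have sum0: "(\<Sum>i\<in>T. card ((\<lambda>p. p i) ` P) - 1) \<le> K" by simp
    have "box lo K \<subseteq> box lo (Suc K)" by (force simp: box_def)
    then have sub: "rmul_comb P \<mu> (rmul b f) \<in> I" if "b \<in> box lo K" for b
      using Suc.prems(6) that by blast
    show ?thesis
      by (rule Suc.IH[where P = P and \<mu> = \<mu>]) (fact Suc.prems(1-5) sub sum0)+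
  next
    case True
    then obtain i p0 p1 where i: "i \<in> T" and p0: "p0 \<in> P" and p1: "p1 \<in> P" "p1 i \<noteq> p0 i" by blast
    obtain j where j: "j < n" and sep: "\<And>p p'. \<beta> (unit_vec j) p / \<beta> p (unit_vec j)
      = \<beta> (unit_vec j) p' / \<beta> p' (unit_vec j) \<longleftrightarrow> p i = p' i"
      using T(2)[OF i] unfolding separated_def by blast
    define e where "e = unit_vec j"
    define \<theta> where "\<theta> p = \<beta> e p / \<beta> p e" for p
    have \<theta>: "\<theta> p = \<theta> p' \<longleftrightarrow> p i = p' i" for p p' using sep by (simp add: \<theta>_def e_def)
    have eG: "e \<in> G" using j by (simp add: e_def)
    \<comment> \<open>The terms agreeing with \<open>p0\<close> in coordinate \<open>i\<close> get
      cancelled; the others keep nonzero coefficients since \<open>\<theta>\<close> separates the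
      values of that coordinate.\<close>
    define P' where "P' = {p \<in> P. p i \<noteq> p0 i}"
    define \<mu>' where "\<mu>' p = \<mu> p * (\<theta> p - \<theta> p0)" for p
    show ?thesis
    proof (rule Suc.IH[of P' \<mu>'])
      show "finite P'" "P' \<noteq> {}" "P' \<subseteq> G" using Suc.prems(1-3) p1 by (auto simp: P'_def)
      show "p k = 0" if "p \<in> P'" "k \<notin> T" for p k using that Suc.prems(4) by (auto simp: P'_def)
      show "\<mu>' p \<noteq> 0" if "p \<in> P'" for p using that Suc.prems(5) \<theta>[of p p0] by (auto simp: P'_def \<mu>'_def)
      show "rmul_comb P' \<mu>' (rmul b f) \<in> I" if b: "b \<in> box lo K" for b
      proof -
        let ?F = "rmul b f"
        have "b + e \<in> box lo (Suc K)" and "b \<in> box lo (Suc K)"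
          using b eG by (force simp: box_def e_def unit_vec_def)+
        then have *: "rmul_comb P \<mu> (rmul (b + e) f) \<in> I" and **: "rmul_comb P \<mu> ?F \<in> I"
          using Suc.prems(6) by blast+
        \<comment> \<open>The extra layer in \<open>box lo (Suc K)\<close> allows the translate by
          \<open>e\<close>. Commuting \<open>e\<close> outwards multiplies each coefficient by
          \<open>\<theta> p\<close>; subtracting \<open>\<theta> p0\<close> times the original
          relation gives the coefficients \<open>\<mu>'\<close>.\<close>
        have "rmul_comb P \<mu> (rmul e ?F) = (\<lambda>x. \<beta> b e * rmul_comb P \<mu> (rmul (b + e) f) x)"
          by (simp add: rmul_comb_def rmul_rmul rmul_scale lincomb_def sum_distrib_left mult.left_commute)
        then have "rmul_comb P \<mu> (rmul e ?F) \<in> I" using ideal_scale[OF I *] by simp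
        also have "rmul_comb P \<mu> (rmul e ?F) = rmul e (rmul_comb P (\<lambda>p. \<mu> p * \<theta> p) ?F)"
          unfolding rmul_comb_def rmul_lincomb rmul_conj[of _ e] \<theta>_def by (simp add: lincomb_def mult.assoc)
        finally have "rmul_comb P (\<lambda>p. \<mu> p * \<theta> p) ?F \<in> I" by (rule ideal_rmulD[OF I eG])
        then have "rmul_comb P (\<lambda>p. \<mu> p * \<theta> p) ?F - (\<lambda>x. \<theta> p0 * rmul_comb P \<mu> ?F x) \<in> I"
          using ideal_diff[OF I] ideal_scale[OF I **] by blast
        also have "rmul_comb P (\<lambda>p. \<mu> p * \<theta> p) ?F - (\<lambda>x. \<theta> p0 * rmul_comb P \<mu> ?F x) = rmul_comb P \<mu>' ?F"
          by (simp add: rmul_comb_def lincomb_def fun_eq_iff \<mu>'_def sum_distrib_left algebra_simps sum_subtractf)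
        also have "rmul_comb P \<mu>' ?F = rmul_comb P' \<mu>' ?F"
        proof
          fix x
          have "(\<Sum>p\<in>P'. \<mu>' p * rmul p ?F x) = (\<Sum>p\<in>P. \<mu>' p * rmul p ?F x)"
            using Suc.prems(1) \<theta>[of _ p0]
            by (intro sum.mono_neutral_left) (auto simp: P'_def \<mu>'_def)
          then show "rmul_comb P \<mu>' ?F x = rmul_comb P' \<mu>' ?F x"
            by (simp add: rmul_comb_def lincomb_def)
        qed
        finally show ?thesis .
      qed
      \<comment> \<open>One of at least two values of coordinate \<open>i\<close> disappears, so the
        natural-number difference really decreases.\<close>
      have img: "(\<lambda>p. p i) ` P' = (\<lambda>p. p i) ` P - {p0 i}" by (auto simp: P'_def)
      have "2 \<le> card ((\<lambda>p. p i) ` P)"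
        using card_le_Suc0_iff_eq[of "(\<lambda>p. p i) ` P"] Suc.prems(1) p0 p1 by (force simp: not_less_eq_eq)
      then have less: "card ((\<lambda>p. p i) ` P') - 1 < card ((\<lambda>p. p i) ` P) - 1"
        unfolding img using p0 Suc.prems(1) by (subst card_Diff_singleton) auto
      have "(\<Sum>i\<in>T. card ((\<lambda>p. p i) ` P') - 1) < (\<Sum>i\<in>T. card ((\<lambda>p. p i) ` P) - 1)"
      proof (rule sum_strict_mono_ex1[OF finT])
        show "\<forall>k\<in>T. card ((\<lambda>p. p k) ` P') - 1 \<le> card ((\<lambda>p. p k) ` P) - 1"
          using Suc.prems(1) by (auto intro!: diff_le_mono card_mono simp: P'_def)
      qed (use less i in blast)
      then show "(\<Sum>i\<in>T. card ((\<lambda>p. p i) ` P') - 1) \<le> K" using Suc.prems(7) by linarith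
    qed
  qed
qed

lemma support_bounded:
  assumes "f \<in> C" shows "\<exists>h::nat. \<forall>x i. f x \<noteq> 0 \<longrightarrow> \<bar>x i\<bar> \<le> int h"
proof -
  have "finite ((\<lambda>(x, i). nat \<bar>x i\<bar>) ` ({x. f x \<noteq> 0} \<times> {..<n}))" using C_finite[OF assms] by blast
  then obtain h where h: "\<forall>y\<in>(\<lambda>(x, i). nat \<bar>x i\<bar>) ` ({x. f x \<noteq> 0} \<times> {..<n}). y < h"
    using finite_nat_set_iff_bounded by blast
  have "\<bar>x i\<bar> \<le> int h" if "f x \<noteq> 0" for x i
  proof (cases "i < n")
    case True
    then have "nat \<bar>x i\<bar> < h" using h that by force
    then show ?thesis by linarith
  next
    case False
    then show ?thesis using C_supp[OF assms that] by (simp add: Zn_def)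
  qed
  then show ?thesis by blast
qed

lemma deg_le_bound:
  assumes "x \<in> G" "\<And>i. x i \<le> M" shows "deg x \<le> int n * M"
  unfolding deg_def using sum_bounded_above[of "{..<n}" x M] assms by simp

text \<open>A dimension count: modulo \<open>I\<close>, the layers of \<open>f\<close> and their
  products with the cube \<open>P\<close> lie in the span of \<open>card DN\<close> vectors. Linear
  maps from the layers to that span form a space of dimension at most
  \<open>card DN * card DN\<close>, which is less than \<open>card P\<close>. So a nonzero
  combination of the cube annihilates all layers, and \<open>separation\<close> puts
  \<open>f\<close> into \<open>I\<close>.\<close>

lemma bernstein_inequality:
  assumes T: "T \<subseteq> {..<n}" "\<And>i. i \<in> T \<Longrightarrow> separated i" "card T = 2 * m"
    and I: "I \<in> L" and J: "J \<in> L" and IJ: "I \<subset> J"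
  shows "\<not> dimlt (lexp J - lexp I) m"
proof
  let ?D = "lexp J - lexp I"
  assume dim: "dimlt ?D m"
  have finT: "finite T" using T(1) finite_subset by blast
  obtain M where "determined M ?D" using up_diff_determined up_lexp I J by blast
  from dimlt_growth[OF this dim] obtain K0 where
    growth: "\<And>N. card {x \<in> ?D. deg x \<le> int N} * (N + 1) \<le> K0 * (N + 1) ^ m" by blast
  obtain f where f: "f \<in> J" "f \<notin> I" using IJ by blast
  obtain h :: nat where h: "\<And>x i. f x \<noteq> 0 \<Longrightarrow> \<bar>x i\<bar> \<le> int h"
    using support_bounded[OF ideal_C[OF J f(1)]] by blast
  \<comment> \<open>Chosen so that every product \<open>rmul p (rmul b f)\<close> considered below
    has degree at most \<open>c * k\<close>, as checked in \<open>bound\<close>; the last summand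
    makes \<open>c\<close> positive even for \<open>n = 0\<close>.\<close>
  define c where "c = n * (2 * h + 2 * m + 1) + 1"
  obtain k where k: "1 \<le> k"
    "card {x \<in> ?D. deg x \<le> int (c * k)} * card {x \<in> ?D. deg x \<le> int (c * k)} < k ^ (2 * m)"
    using polynomial_growth_contradiction[of "\<lambda>N. card {x \<in> ?D. deg x \<le> int N}" K0 m c] growth
    by (auto simp: c_def)
  define N where "N = c * k"
  define DN where "DN = {x \<in> ?D. deg x \<le> int N}"
  \<comment> \<open>\<open>separation\<close> eliminates at most \<open>k\<close> values in each of
    the \<open>2 * m\<close> coordinates of \<open>T\<close>.\<close>
  define K where "K = 2 * m * k"
  \<comment> \<open>Translation by at least \<open>h\<close> in each coordinate moves the support of
    \<open>f\<close> into \<open>cone\<close>.\<close>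
  define B where "B = box (int h) K"
  define P where "P = expo_cube T k"
  have finP: "finite P" and cardP: "card P = k ^ (2 * m)" using expo_cube_card[OF finT] T(3) by (simp_all add: P_def)
  have PG: "P \<subseteq> G"
    using expo_cubeD(1)[of _ T k] T(1) by (force simp: P_def Zn_def)
  have finB: "finite B"
  proof (rule finite_subset)
    show "B \<subseteq> {b. \<forall>i. (i \<in> {..<n} \<longrightarrow> b i \<in> {int h..int h + int K}) \<and> (i \<notin> {..<n} \<longrightarrow> b i = 0)}"
      by (auto simp: B_def box_def Zn_def)
    show "finite {b :: nat \<Rightarrow> int. \<forall>i. (i \<in> {..<n} \<longrightarrow> b i \<in> {int h..int h + int K}) \<and> (i \<notin> {..<n} \<longrightarrow> b i = 0)}"
      by (rule finite_set_of_finite_funs) auto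
  qed
  have finDN: "finite DN"
    by (rule finite_subset[OF _ finite_cone_deg[of "int N"]]) (use lexp_cone in \<open>auto simp: DN_def\<close>)
  have BG: "b \<in> G" if "b \<in> B" for b using that by (simp add: B_def box_def)
  have "\<forall>e. \<exists>g. e \<in> ?D \<longrightarrow> g \<in> J \<and> pos g \<and> lead g e" by (auto simp: lexp_def)
  then obtain g where g: "\<And>e. e \<in> ?D \<Longrightarrow> g e \<in> J \<and> pos (g e) \<and> lead (g e) e" by metis
  have bound: "n * (2 * h + K + k) \<le> N"
  proof -
    have "2 * h * 1 \<le> 2 * h * k" using k(1) by (intro mult_le_mono2)
    then have "2 * h + K + k \<le> (2 * h + 2 * m + 1) * k" using k(1) by (simp add: K_def algebra_simps)
    then have "n * (2 * h + K + k) \<le> n * ((2 * h + 2 * m + 1) * k)" by (rule mult_le_mono2)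
    also have "\<dots> \<le> N" by (simp add: N_def c_def algebra_simps)
    finally show ?thesis .
  qed
  have span: "\<exists>\<gamma>. rmul p (rmul b f) - lincomb DN \<gamma> g \<in> I"
    if b: "b \<in> B" and p: "p \<in> G" "\<And>i. 0 \<le> p i" "\<And>i. p i \<le> int k" for b p
  proof -
    have supp: "x \<in> cone \<and> deg x \<le> int N" if "rmul p (rmul b f) x \<noteq> 0" for x
    proof -
      have nz: "f (x - p - b) \<noteq> 0" using that by (auto simp: rmul_def)
      have "x - p - b \<in> G" using C_supp[OF ideal_C[OF J f(1)] nz] .
      from Zn_add[OF Zn_add[OF this BG[OF b]] p(1)] have xG: "x \<in> G" by simp
      have bnd: "0 \<le> x i \<and> x i \<le> int (2 * h + K + k)" for i
      proof (cases "i < n")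
        case True
        have "\<bar>x i - p i - b i\<bar> \<le> int h" using h[OF nz, of i] by simp
        moreover have "int h \<le> b i" "b i \<le> int h + int K" using b True by (auto simp: B_def box_def)
        ultimately show ?thesis using p(2)[of i] p(3)[of i] by auto
      next
        case False
        then show ?thesis using xG by (simp add: Zn_def)
      qed
      have "deg x \<le> int n * int (2 * h + K + k)" using deg_le_bound[OF xG] bnd by blast
      also have "\<dots> \<le> int N" using bound by (metis of_nat_le_iff of_nat_mult)
      finally show ?thesis using xG bnd by (auto simp: cone_def)
    qed
    show ?thesis unfolding DN_def
    proof (rule lexp_diff_spans[OF I J _ g])
      show "rmul p (rmul b f) \<in> J" using ideal_rmul[OF J] p(1) BG[OF b] f(1) by blast
      show "pos (rmul p (rmul b f))" using supp by (auto simp: pos_def)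
    qed (use IJ supp in auto)
  qed
  have "\<forall>b. \<exists>\<gamma>. b \<in> B \<longrightarrow> rmul b f - lincomb DN \<gamma> g \<in> I"
  proof
    fix b
    show "\<exists>\<gamma>. b \<in> B \<longrightarrow> rmul b f - lincomb DN \<gamma> g \<in> I"
      using span[of b 0] by (cases "b \<in> B") auto
  qed
  then obtain \<gamma> where \<gamma>: "\<And>b. b \<in> B \<Longrightarrow> rmul b f - lincomb DN (\<gamma> b) g \<in> I" by metis
  \<comment> \<open>Modulo \<open>I\<close> at most \<open>card DN\<close> layers span all of them,
    so it suffices to annihilate those.\<close>
  obtain S where S: "S \<subseteq> B" "card S \<le> card DN"
    "\<And>b. b \<in> B \<Longrightarrow> \<exists>\<mu>. rmul b f - lincomb S \<mu> (\<lambda>b. rmul b f) \<in> I"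
    using spanning_subfamily_mod[OF ideal_subspace[OF I] finB finDN, of "\<lambda>b. rmul b f" \<gamma> g] \<gamma> by blast
  have finS: "finite S" using S(1) finB finite_subset by blast
  have "\<forall>t p. \<exists>\<gamma>. t \<in> S \<and> p \<in> P \<longrightarrow> rmul p (rmul t f) - lincomb DN \<gamma> g \<in> I"
  proof (intro allI)
    fix t p
    show "\<exists>\<gamma>. t \<in> S \<and> p \<in> P \<longrightarrow> rmul p (rmul t f) - lincomb DN \<gamma> g \<in> I"
    proof (cases "t \<in> S \<and> p \<in> P")
      case True
      then show ?thesis using span[of t p] S(1) PG expo_cubeD[of p T k] by (auto simp: P_def)
    qed blast
  qed
  then obtain \<Gamma> where \<Gamma>: "\<And>t p. t \<in> S \<Longrightarrow> p \<in> P \<Longrightarrow> rmul p (rmul t f) - lincomb DN (\<Gamma> t p) g \<in> I" by metis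
  \<comment> \<open>The unknowns are the \<open>k ^ (2 * m)\<close> coefficients on
    \<open>P\<close>; each pair in \<open>S \<times> DN\<close> gives one equation, the vanishing of
    an expansion coefficient of an image.\<close>
  have "card (S \<times> DN) \<le> card DN * card DN" using S(2) by (simp add: card_cartesian_product)
  then have "card (S \<times> DN) < card P" using k(2) cardP by (simp add: DN_def N_def)
  then obtain \<mu> where \<mu>: "\<exists>p\<in>P. \<mu> p \<noteq> 0"
    "\<forall>e\<in>S \<times> DN. (\<Sum>p\<in>P. \<mu> p * (\<lambda>(t, e). \<Gamma> t p e) e) = 0"
    using homogeneous_system_nontrivial[of "S \<times> DN" P "\<lambda>p (t, e). \<Gamma> t p e"] finS finDN finP by auto
  have S0: "rmul_comb P \<mu> (rmul t f) \<in> I" if "t \<in> S" for t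
    unfolding rmul_comb_def
    by (rule lincomb_mod_spanning[OF ideal_subspace[OF I], where E = DN and \<gamma> = "\<Gamma> t" and g = g])
      (use \<Gamma> \<mu>(2) that in auto)
  have B0: "rmul_comb P \<mu> (rmul b f) \<in> I" if b: "b \<in> B" for b
  proof -
    obtain \<nu> where \<nu>: "rmul b f - lincomb S \<nu> (\<lambda>b. rmul b f) \<in> I" using S(3)[OF b] by blast
    let ?d = "rmul b f - lincomb S \<nu> (\<lambda>b. rmul b f)" and ?l = "lincomb S \<nu> (\<lambda>t. rmul_comb P \<mu> (rmul t f))"
    have "?l \<in> I" using S0 by (rule lin_subspace_lincomb[OF ideal_subspace[OF I]])
    then have "rmul_comb P \<mu> ?d + ?l \<in> I"
      using rmul_comb_ideal[OF I PG \<nu>] ideal_add[OF I] by blast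
    then show ?thesis unfolding rmul_comb_diff rmul_comb_lincomb by simp
  qed
  have "f \<in> I"
  proof (rule separation[OF I T(1,2), where P = "{p \<in> P. \<mu> p \<noteq> 0}" and \<mu> = \<mu> and lo = "int h" and K = K])
    let ?P = "{p \<in> P. \<mu> p \<noteq> 0}"
    show "finite ?P" "?P \<noteq> {}" "?P \<subseteq> G" using finP \<mu>(1) PG by auto
    show "p i = 0" if "p \<in> ?P" "i \<notin> T" for p i using that expo_cubeD(1) by (auto simp: P_def)
    show "\<mu> p \<noteq> 0" if "p \<in> ?P" for p using that by simp
    show "rmul_comb ?P \<mu> (rmul b f) \<in> I" if "b \<in> box (int h) K" for b
    proof -
      have "rmul_comb ?P \<mu> (rmul b f) = rmul_comb P \<mu> (rmul b f)"
      proof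
        fix x
        have "(\<Sum>p\<in>?P. \<mu> p * rmul p (rmul b f) x) = (\<Sum>p\<in>P. \<mu> p * rmul p (rmul b f) x)"
          using finP by (intro sum.mono_neutral_left) auto
        then show "rmul_comb ?P \<mu> (rmul b f) x = rmul_comb P \<mu> (rmul b f) x"
          by (simp add: rmul_comb_def lincomb_def)
      qed
      then show ?thesis using B0 that by (simp add: B_def)
    qed
    have "card ((\<lambda>p. p i) ` ?P) - 1 \<le> k" if i: "i \<in> T" for i
    proof -
      have "(\<lambda>p. p i) ` ?P \<subseteq> {0..<int k}" using expo_cubeD(2,3) i by (auto simp: P_def)
      then have "card ((\<lambda>p. p i) ` ?P) \<le> card {0..<int k}" by (rule card_mono[rotated]) simp
      then show ?thesis by simp
    qed
    then have "(\<Sum>i\<in>T. card ((\<lambda>p. p i) ` ?P) - 1) \<le> (\<Sum>i\<in>T. k)" by (rule sum_mono)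
    then show "(\<Sum>i\<in>T. card ((\<lambda>p. p i) ` ?P) - 1) \<le> K" using T(3) by (simp add: K_def)
  qed
  then show False using f(2) by blast
qed

text \<open>The interval from \<open>{0}\<close> to \<open>C\<close> is the whole poset. It has
  growth dimension at most \<open>n\<close>, and the Bernstein inequality bounds that of nonzero
  subquotients below by \<open>m\<close>.\<close>

lemma dev_less_upper:
  assumes T: "T \<subseteq> {..<n}" "\<And>i. i \<in> T \<Longrightarrow> separated i" "card T = 2 * m"
  shows "dev_less (Suc (n - m)) L"
proof -
  have "2 * m \<le> n" using card_mono[of "{..<n}" T] T by simp
  then have eq: "m + Suc (n - m) = Suc n" by simp
  have 0: "{0} \<in> L"
    unfolding right_ideal_iff using C_subspace by (auto simp: lin_subspace_def rmul_def zero_fun_def)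
  have "dev_less (Suc (n - m)) {x \<in> L. {0} \<subseteq> x \<and> x \<subseteq> C}"
  proof (rule dev_less_of_min_dim[OF _ 0 C_in_L])
    show "\<not> dimlt (lexp J - lexp I) m" if "I \<in> L" "J \<in> L" "I \<subset> J" for I J
      using bernstein_inequality[OF T that] .
    show "{0} \<subseteq> C" using ideal_0[OF C_in_L] by simp
    show "dimlt (lexp C - lexp {0}) (m + Suc (n - m))" unfolding eq by (rule dimlt_Suc_n)
  qed
  moreover have "L \<subseteq> {x \<in> L. {0} \<subseteq> x \<and> x \<subseteq> C}"
    using ideal_0 ideal_C by blast
  ultimately show ?thesis by (rule dev_less_subset)
qed

end


section \<open>Commutative subtori bound the deviation from below\<close>

context bichar_torus
begin

text \<open>In the chain of the \<open>t^i C + N\<close>, each factor receives the right ideals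
  above \<open>N'\<close> through the map sending \<open>I\<close> to \<open>t^i I + N\<close>. This
  map is strictly monotone because \<open>t\<close> is injective modulo \<open>N\<close>, so no
  factor satisfies \<open>dev_less k\<close>.\<close>

lemma not_dev_less_step:
  fixes t :: "((nat \<Rightarrow> int) \<Rightarrow> 'a) \<Rightarrow> (nat \<Rightarrow> int) \<Rightarrow> 'a"
  assumes N: "N \<in> L" and N': "N' \<in> L" and NN': "N \<subseteq> N'"
    and t_C: "\<And>f. f \<in> C \<Longrightarrow> t f \<in> C"
    and t_add: "\<And>f g. t (f + g) = t f + t g"
    and t_scale: "\<And>c f. t (\<lambda>x. c * f x) = (\<lambda>x. c * t f x)"
    and t_rmul: "\<And>p f. t (rmul p f) = rmul p (t f)"
    and t_N: "\<And>f. f \<in> N \<Longrightarrow> t f \<in> N"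
    and t_reg: "\<And>f. f \<in> C \<Longrightarrow> t f \<in> N \<Longrightarrow> f \<in> N"
    and t_N': "\<And>f. f \<in> C \<Longrightarrow> t f \<in> N'"
    and not_dev: "\<not> dev_less k {I \<in> L. N' \<subseteq> I}"
  shows "\<not> dev_less (Suc k) {I \<in> L. N \<subseteq> I}"
proof
  assume dev: "dev_less (Suc k) {I \<in> L. N \<subseteq> I}"
  have it_C: "(t ^^ i) f \<in> C" if "f \<in> C" for i f using that t_C by (induction i) auto
  have it_add: "(t ^^ i) (f + g) = (t ^^ i) f + (t ^^ i) g" for i f g
  proof (induction i)
    case (Suc i)
    then show ?case by (simp only: funpow.simps o_apply t_add)
  qed simp
  have it_scale: "(t ^^ i) (\<lambda>x. c * f x) = (\<lambda>x. c * (t ^^ i) f x)" for i c f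
    by (induction i) (simp_all add: t_scale)
  have it_rmul: "(t ^^ i) (rmul p f) = rmul p ((t ^^ i) f)" for i p f
    by (induction i) (simp_all add: t_rmul)
  have it_diff: "(t ^^ i) (f - g) = (t ^^ i) f - (t ^^ i) g" for i f g
    using it_add[of i "f - g" g] by (simp add: algebra_simps)
  have it_0: "(t ^^ i) 0 = 0" for i using it_diff[of i 0 0] by simp
  have it_reg: "f \<in> N" if "f \<in> C" "(t ^^ i) f \<in> N" for i f
    using that by (induction i) (auto intro: t_reg it_C)
  define \<phi> where "\<phi> i I = {(t ^^ i) g + m | g m. g \<in> I \<and> m \<in> N}" for i I
  have \<phi>I: "(t ^^ i) g + m \<in> \<phi> i I" if "g \<in> I" "m \<in> N" for i I g m using that by (auto simp: \<phi>_def)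
  have \<phi>_mono: "\<phi> i I \<subseteq> \<phi> i J" if "I \<subseteq> J" for i I J using that by (auto simp: \<phi>_def)
  have N\<phi>: "N \<subseteq> \<phi> i I" if "I \<in> L" for i I
    using \<phi>I[OF ideal_0[OF that], of _ i] by (auto simp: it_0)
  have \<phi>_L: "\<phi> i I \<in> L" if I: "I \<in> L" for i I
    unfolding right_ideal_iff lin_subspace_def
  proof (intro conjI ballI allI subsetI)
    show "0 \<in> \<phi> i I" using N\<phi>[OF I] ideal_0[OF N] by blast
    fix f assume "f \<in> \<phi> i I"
    then obtain g m where f: "f = (t ^^ i) g + m" "g \<in> I" "m \<in> N" by (auto simp: \<phi>_def)
    show "f \<in> C" unfolding f(1)
      using ideal_add[OF C_in_L it_C[OF ideal_C[OF I f(2)]] ideal_C[OF N f(3)]] .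
    show "(\<lambda>x. c * f x) \<in> \<phi> i I" for c
    proof -
      have "(\<lambda>x. c * f x) = (t ^^ i) (\<lambda>x. c * g x) + (\<lambda>x. c * m x)"
        by (simp add: f(1) it_scale fun_eq_iff algebra_simps)
      then show ?thesis using \<phi>I[OF ideal_scale[OF I f(2)] ideal_scale[OF N f(3)]] by metis
    qed
    show "rmul p f \<in> \<phi> i I" if "p \<in> G" for p
      using \<phi>I[OF ideal_rmul[OF I that f(2)] ideal_rmul[OF N that f(3)], of i]
      by (simp add: f(1) rmul_add it_rmul)
    fix f' assume "f' \<in> \<phi> i I"
    then obtain g' m' where f': "f' = (t ^^ i) g' + m'" "g' \<in> I" "m' \<in> N" by (auto simp: \<phi>_def)
    have "f + f' = (t ^^ i) (g + g') + (m + m')" by (simp add: f(1) f'(1) it_add algebra_simps)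
    then show "f + f' \<in> \<phi> i I" using \<phi>I[OF ideal_add[OF I f(2) f'(2)] ideal_add[OF N f(3) f'(3)]] by metis
  qed
  define a where "a i = \<phi> i C" for i
  \<comment> \<open>Since \<open>t\<close> maps \<open>C\<close> into \<open>N'\<close>, the next
    chain member already lies in \<open>t^i I + N\<close>.\<close>
  have low: "a (Suc i) \<subseteq> \<phi> i I" if "N' \<subseteq> I" for i I
  proof
    fix f assume "f \<in> a (Suc i)"
    then obtain g m where f: "f = (t ^^ Suc i) g + m" "g \<in> C" "m \<in> N" by (auto simp: a_def \<phi>_def)
    have "t g \<in> I" using t_N'[OF f(2)] that by blast
    then have "(t ^^ i) (t g) + m \<in> \<phi> i I" using f(3) by (rule \<phi>I)
    then show "f \<in> \<phi> i I" by (simp add: f(1) funpow_swap1)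
  qed
  have "\<forall>i. a i \<in> {I \<in> L. N \<subseteq> I} \<and> a (Suc i) \<subseteq> a i"
  proof
    fix i
    have "a (Suc i) \<subseteq> a i" unfolding a_def[of i] by (rule low) (use ideal_C[OF N'] in blast)
    then show "a i \<in> {I \<in> L. N \<subseteq> I} \<and> a (Suc i) \<subseteq> a i"
      using \<phi>_L[OF C_in_L, of i] N\<phi>[OF C_in_L, of i] by (simp add: a_def)
  qed
  then obtain i where i: "dev_less k {x \<in> {I \<in> L. N \<subseteq> I}. a (Suc i) \<subseteq> x \<and> x \<subseteq> a i}"
    using dev unfolding dev_less.simps(2) by blast
  have "dev_less k {I \<in> L. N' \<subseteq> I}"
  proof (rule dev_less_strict_embedding[OF i])
    fix I assume "I \<in> {I \<in> L. N' \<subseteq> I}"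
    then have I: "I \<in> L" "N' \<subseteq> I" by auto
    have "I \<subseteq> C" using ideal_C[OF I(1)] by blast
    then show "\<phi> i I \<in> {x \<in> {I \<in> L. N \<subseteq> I}. a (Suc i) \<subseteq> x \<and> x \<subseteq> a i}"
      using \<phi>_L[OF I(1)] N\<phi>[OF I(1)] low[OF I(2)] \<phi>_mono unfolding a_def by blast
    fix I' assume "I' \<in> {I \<in> L. N' \<subseteq> I}" and II': "I \<subset> I'"
    then have I': "I' \<in> L" by auto
    obtain x where x: "x \<in> I'" "x \<notin> I" using II' by blast
    have "(t ^^ i) x \<in> \<phi> i I'" using \<phi>I[OF x(1) ideal_0[OF N], of i] by simp
    moreover have "(t ^^ i) x \<notin> \<phi> i I"
    proof
      assume "(t ^^ i) x \<in> \<phi> i I"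
      \<comment> \<open>Then \<open>t^i (x - y)\<close> lies in \<open>N\<close>, and regularity
        puts \<open>x - y\<close> into \<open>N\<close>, hence into \<open>I\<close>.\<close>
      then obtain y m where y: "(t ^^ i) x = (t ^^ i) y + m" "y \<in> I" "m \<in> N" by (auto simp: \<phi>_def)
      have "(t ^^ i) (x - y) \<in> N" using y by (simp add: it_diff)
      moreover have "x - y \<in> C"
        using ideal_diff[OF C_in_L ideal_C[OF I' x(1)] ideal_C[OF I(1) y(2)]] .
      ultimately have "x - y \<in> I" using it_reg NN' I(2) by blast
      from ideal_add[OF I(1) this y(2)] have "x \<in> I" by simp
      then show False using x(2) by blast
    qed
    ultimately show "\<phi> i I \<subset> \<phi> i I'" using \<phi>_mono[of I I' i] II' by blast
  qed
  then show False using not_dev by blast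
qed

end

text \<open>On the lattice \<open>H U\<close> the cocycle is trivial, so its basis elements multiply
  as in a Laurent polynomial ring. Subsets \<open>W\<close> of \<open>U\<close> index the directions
  already specialised to \<open>1\<close>.\<close>

locale commutative_subtorus = bichar_torus n \<beta> for n and \<beta> :: "(nat \<Rightarrow> int) \<Rightarrow> (nat \<Rightarrow> int) \<Rightarrow> 'a::field" +
  fixes U :: "nat set" and \<omega> :: "nat \<Rightarrow> int" and H
  defines "H \<equiv> \<lambda>W. {a \<in> Zn n. \<forall>i. (i \<in> W \<longrightarrow> \<omega> i dvd a i) \<and> (i \<notin> W \<longrightarrow> a i = 0)}"
  assumes U: "U \<subseteq> {..<n}" and \<omega>: "\<And>i. i \<in> U \<Longrightarrow> 0 < \<omega> i"
    and trivial: "\<And>a b. a \<in> H U \<Longrightarrow> b \<in> H U \<Longrightarrow> \<beta> a b = 1"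
begin

lemma H_mono: "W \<subseteq> W' \<Longrightarrow> H W \<subseteq> H W'"
  unfolding H_def by (clarsimp, metis dvd_0_right subsetD)

lemma H_add: "a \<in> H W \<Longrightarrow> b \<in> H W \<Longrightarrow> a + b \<in> H W"
  and H_diff: "a \<in> H W \<Longrightarrow> b \<in> H W \<Longrightarrow> a - b \<in> H W"
  by (auto simp: H_def)

text \<open>The coefficient at the coset of \<open>g\<close> of the image of \<open>f\<close> in the quotient by the right ideal
  generated by all \<open>x\<^sup>a - 1\<close> with \<open>a \<in> H W\<close>.\<close>

definition coset_sum :: "nat set \<Rightarrow> ((nat \<Rightarrow> int) \<Rightarrow> 'a) \<Rightarrow> (nat \<Rightarrow> int) \<Rightarrow> 'a" where
  "coset_sum W f g = (\<Sum>a | a \<in> H W \<and> f (a + g) \<noteq> 0. f (a + g) / \<beta> a g)"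

lemma finite_coset: "f \<in> C \<Longrightarrow> finite {a. a \<in> H W \<and> f (a + g) \<noteq> 0}"
proof (rule finite_imageD)
  assume "f \<in> C"
  show "finite ((\<lambda>a. a + g) ` {a. a \<in> H W \<and> f (a + g) \<noteq> 0})"
    by (rule finite_subset[OF _ C_finite[OF \<open>f \<in> C\<close>]]) auto
qed (auto simp: inj_on_def)

lemma coset_sum_superset:
  assumes "finite A" "A \<subseteq> H W" "\<And>a. a \<in> H W \<Longrightarrow> f (a + g) \<noteq> 0 \<Longrightarrow> a \<in> A"
  shows "coset_sum W f g = (\<Sum>a\<in>A. f (a + g) / \<beta> a g)"
  unfolding coset_sum_def by (rule sum.mono_neutral_left) (use assms in auto)

lemma coset_sum_diff:
  assumes "f \<in> C" "f' \<in> C"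
  shows "coset_sum W (f - f') g = coset_sum W f g - coset_sum W f' g"
proof -
  let ?A = "{a. a \<in> H W \<and> f (a + g) \<noteq> 0} \<union> {a. a \<in> H W \<and> f' (a + g) \<noteq> 0}"
  have fin: "finite ?A" using finite_coset assms by blast
  have "coset_sum W h g = (\<Sum>a\<in>?A. h (a + g) / \<beta> a g)"
    if "\<And>x. h x \<noteq> 0 \<Longrightarrow> f x \<noteq> 0 \<or> f' x \<noteq> 0" for h
    by (rule coset_sum_superset[OF fin]) (use that in auto)
  note * = this
  have "f x \<noteq> 0 \<or> f' x \<noteq> 0" if "(f - f') x \<noteq> 0" for x using that by auto
  from *[of "f - f'", OF this] *[of f] *[of f'] show ?thesis
    by (simp add: diff_divide_distrib sum_subtractf)
qed

lemma coset_sum_scale: "f \<in> C \<Longrightarrow> coset_sum W (\<lambda>x. c * f x) g = c * coset_sum W f g"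
  by (subst coset_sum_superset[OF finite_coset[of f W g]]) (auto simp: coset_sum_def sum_distrib_left)

lemma coset_sum_rmul: "coset_sum W (rmul p f) g = \<beta> (g - p) p * coset_sum W f (g - p)"
proof -
  have "rmul p f (a + g) / \<beta> a g = \<beta> (g - p) p * (f (a + (g - p)) / \<beta> a (g - p))" for a
    by (simp add: rmul_def \<beta>_add_left \<beta>_diff_left \<beta>_diff_right add_diff_eq)
  moreover have "rmul p f (a + g) \<noteq> 0 \<longleftrightarrow> f (a + (g - p)) \<noteq> 0" for a
    by (simp add: rmul_def add_diff_eq)
  ultimately show ?thesis by (simp only: coset_sum_def sum_distrib_left)
qed

lemma coset_sum_lmul:
  assumes "W \<subseteq> U" "h \<in> H U"
  shows "coset_sum W (lmul h f) g = \<beta> h (g - h) * coset_sum W f (g - h)"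
proof -
  have "lmul h f (a + g) / \<beta> a g = \<beta> h (g - h) * (f (a + (g - h)) / \<beta> a (g - h))" if "a \<in> H W" for a
    using trivial[of h a] trivial[of a h] that assms H_mono[OF assms(1)]
    by (auto simp: lmul_def \<beta>_add_right \<beta>_diff_right add_diff_eq)
  moreover have "lmul h f (a + g) \<noteq> 0 \<longleftrightarrow> f (a + (g - h)) \<noteq> 0" for a
    by (simp add: lmul_def add_diff_eq)
  ultimately show ?thesis unfolding coset_sum_def sum_distrib_left by (intro sum.cong) auto
qed

text \<open>Translation of the summation index by \<open>h\<close>. Compared with
  \<open>coset_sum_lmul\<close>, it shows that left multiplication by the basis element of
  \<open>h\<close> leaves coset sums over \<open>H W\<close> unchanged.\<close>

lemma coset_sum_shift:
  assumes "W \<subseteq> U" "h \<in> H W"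
  shows "coset_sum W f g = \<beta> h (g - h) * coset_sum W f (g - h)"
proof -
  have hU: "h \<in> H U" using assms H_mono by blast
  have "coset_sum W f g = (\<Sum>a | a \<in> H W \<and> f (a + (g - h)) \<noteq> 0. \<beta> h (g - h) * (f (a + (g - h)) / \<beta> a (g - h)))"
    unfolding coset_sum_def
  proof (rule sum.reindex_bij_witness[where i = "\<lambda>a. a - h" and j = "\<lambda>a. a + h"])
    fix a assume a: "a \<in> {a. a \<in> H W \<and> f (a + g) \<noteq> 0}"
    then have aU: "a \<in> H U" using assms(1) H_mono by blast
    show "\<beta> h (g - h) * (f (a + h + (g - h)) / \<beta> (a + h) (g - h)) = f (a + g) / \<beta> a g"
      using trivial[OF aU hU] trivial[OF hU hU]
      by (simp add: \<beta>_add_left \<beta>_diff_right add.assoc)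
  qed (use H_add H_diff assms(2) in \<open>auto simp: algebra_simps\<close>)
  then show ?thesis by (simp add: coset_sum_def sum_distrib_left)
qed

section \<open>The right ideals of elements with vanishing coset sums\<close>

definition NW :: "nat set \<Rightarrow> ((nat \<Rightarrow> int) \<Rightarrow> 'a) set" where
  "NW W = {f \<in> C. \<forall>g. coset_sum W f g = 0}"

lemma NW_L: "NW W \<in> L"
  unfolding right_ideal_iff lin_subspace_def
proof (intro conjI ballI allI subsetI)
  show "0 \<in> NW W" using ideal_0[OF C_in_L] by (simp add: NW_def coset_sum_def)
  fix f assume f: "f \<in> NW W"
  then show "f \<in> C" by (simp add: NW_def)
  show "(\<lambda>x. c * f x) \<in> NW W" for c
    using f coset_sum_scale ideal_scale[OF C_in_L] by (simp add: NW_def)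
  show "rmul p f \<in> NW W" if "p \<in> G" for p
    using f that coset_sum_rmul rmul_in_C by (simp add: NW_def)
  fix f' assume f': "f' \<in> NW W"
  have neg: "(\<lambda>x. - 1 * f' x) \<in> C" using f' ideal_scale[OF C_in_L] by (simp only: NW_def mem_Collect_eq)
  have "f + f' = f - (\<lambda>x. - 1 * f' x)" by (simp add: fun_eq_iff)
  moreover have "coset_sum W (f - (\<lambda>x. - 1 * f' x)) g = 0" for g
    using f f' neg by (simp only: coset_sum_diff coset_sum_scale NW_def mem_Collect_eq) simp
  moreover have "f - (\<lambda>x. - 1 * f' x) \<in> C" using f neg ideal_diff[OF C_in_L] by (simp only: NW_def mem_Collect_eq)
  ultimately show "f + f' \<in> NW W" by (simp only: NW_def mem_Collect_eq) simp
qed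

text \<open>Grouping a coset of \<open>H (insert i W)\<close> by coordinate \<open>i\<close> splits
  it into cosets of \<open>H W\<close>, over each of which the sum vanishes.\<close>

lemma NW_insert:
  assumes W: "insert i W \<subseteq> U" "i \<notin> W" shows "NW W \<subseteq> NW (insert i W)"
proof
  fix f assume f: "f \<in> NW W"
  have fC: "f \<in> C" using f by (simp add: NW_def)
  have "coset_sum (insert i W) f g = 0" for g
  proof -
    let ?A = "{a. a \<in> H (insert i W) \<and> f (a + g) \<noteq> 0}"
    have fin: "finite ?A" by (rule finite_coset[OF fC])
    have "(\<Sum>a\<in>{a \<in> ?A. a i = y}. f (a + g) / \<beta> a g) = 0" if y: "y \<in> (\<lambda>a. a i) ` ?A" for y
    proof -
      define c where "c = (\<lambda>k. if k = i then y else 0)"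
      have dvd: "\<omega> i dvd y" using y by (auto simp: H_def)
      have cH: "c \<in> H (insert i W)" using W dvd U by (auto simp: H_def c_def Zn_def)
      have cU: "c \<in> H U" using cH H_mono[OF W(1)] by blast
      have "(\<Sum>a\<in>{a \<in> ?A. a i = y}. f (a + g) / \<beta> a g)
          = (\<Sum>a | a \<in> H W \<and> f (a + (c + g)) \<noteq> 0. inverse (\<beta> c g) * (f (a + (c + g)) / \<beta> a (c + g)))"
      proof (rule sum.reindex_bij_witness[where i = "\<lambda>a. a + c" and j = "\<lambda>a. a - c"])
        fix a assume a: "a \<in> {a \<in> ?A. a i = y}"
        then have aH: "a \<in> H (insert i W)" and ai: "a i = y" by auto
        have "a - c \<in> H W" using H_diff[OF aH cH] ai W(2) by (auto simp: H_def c_def)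
        then show "a - c \<in> {a. a \<in> H W \<and> f (a + (c + g)) \<noteq> 0}" using a by (simp add: algebra_simps)
        have aU: "a \<in> H U" using aH H_mono[OF W(1)] by blast
        show "inverse (\<beta> c g) * (f (a - c + (c + g)) / \<beta> (a - c) (c + g)) = f (a + g) / \<beta> a g"
          using trivial[OF aU cU] trivial[OF cU cU]
          by (simp add: \<beta>_diff_left \<beta>_add_right field_simps)
      next
        fix a assume a: "a \<in> {a. a \<in> H W \<and> f (a + (c + g)) \<noteq> 0}"
        have "a \<in> H (insert i W)" using a H_mono[of W "insert i W"] by blast
        moreover have "a i = 0" using a W(2) by (auto simp: H_def)
        ultimately show "a + c \<in> {a \<in> ?A. a i = y}"
          using H_add[OF _ cH, of a] a by (simp add: c_def add.assoc)
      qed auto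
      also have "\<dots> = inverse (\<beta> c g) * coset_sum W f (c + g)"
        by (simp add: coset_sum_def sum_distrib_left)
      also have "\<dots> = 0" using f by (simp add: NW_def)
      finally show ?thesis .
    qed
    then show ?thesis unfolding coset_sum_def by (subst sum.image_gen[OF fin, where g = "\<lambda>a. a i"]) simp
  qed
  then show "f \<in> NW (insert i W)" using fC by (simp add: NW_def)
qed

text \<open>A nonzero coset sum at \<open>g\<close> propagates to \<open>g - k h\<close> for all
  \<open>k\<close>. As elements of \<open>H W\<close> vanish at \<open>i\<close>, the support of
  \<open>f\<close> would then have infinitely many values of coordinate \<open>i\<close>.\<close>

lemma NW_regular:
  assumes W: "insert i W \<subseteq> U" "i \<notin> W" and h: "h \<in> H U" "h i = \<omega> i"
    and f: "f \<in> C" "lmul h f - f \<in> NW W"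
  shows "f \<in> NW W"
proof (rule ccontr)
  assume "f \<notin> NW W"
  then obtain g where g: "coset_sum W f g \<noteq> 0" using f(1) by (auto simp: NW_def)
  have hG: "h \<in> G" using h by (simp add: H_def)
  have step: "coset_sum W f x = \<beta> h (x - h) * coset_sum W f (x - h)" for x
    using f(2) coset_sum_diff[OF lmul_in_C[OF f(1) hG] f(1), of W x] coset_sum_lmul[of W h f x] W h
    by (simp add: NW_def)
  have ex: "\<exists>x. coset_sum W f x \<noteq> 0 \<and> x i = g i - int k * \<omega> i" for k
  proof (induction k)
    case 0
    show ?case using g by auto
  next
    case (Suc k)
    then obtain x where "coset_sum W f x \<noteq> 0" "x i = g i - int k * \<omega> i" by blast
    then have "coset_sum W f (x - h) \<noteq> 0" "(x - h) i = g i - int (Suc k) * \<omega> i"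
      using step[of x] h(2) by (auto simp: algebra_simps)
    then show ?case by blast
  qed
  have "g i - int k * \<omega> i \<in> (\<lambda>x. x i) ` {x. f x \<noteq> 0}" for k
  proof -
    obtain x where x: "coset_sum W f x \<noteq> 0" "x i = g i - int k * \<omega> i" using ex by blast
    then obtain a where a: "a \<in> H W" "f (a + x) \<noteq> 0"
      unfolding coset_sum_def by (metis (mono_tags, lifting) mem_Collect_eq sum.not_neutral_contains_not_neutral)
    have "(a + x) i = g i - int k * \<omega> i" using a(1) x(2) W(2) by (simp add: H_def)
    then show ?thesis using a(2) by (metis (mono_tags, lifting) imageI mem_Collect_eq)
  qed
  then have "finite (range (\<lambda>k::nat. g i - int k * \<omega> i))"
    using C_finite[OF f(1)] by (meson finite_imageI finite_subset image_subsetI)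
  moreover have "0 < \<omega> i" using W \<omega> by blast
  then have "inj (\<lambda>k::nat. g i - int k * \<omega> i)" by (auto simp: inj_def)
  ultimately show False using finite_imageD infinite_UNIV_nat by blast
qed

text \<open>\<open>V\<close> collects the directions still free. Freeing \<open>i\<close> raises the
  deviation by one through left multiplication by the basis element of \<open>\<omega> i\<close>
  times \<open>unit_vec i\<close>, minus the identity.\<close>

lemma not_dev_less_NW:
  assumes "finite V" "V \<subseteq> U"
  shows "\<not> dev_less (card V) {I \<in> L. NW (U - V) \<subseteq> I}"
  using assms
proof (induction V rule: finite_induct)
  case empty
  \<comment> \<open>The unit has coset sum \<open>1\<close> at \<open>0\<close>, so
    \<open>NW U\<close> is a proper right ideal.\<close>
  let ?e = "\<lambda>x. if x = 0 then 1 else 0 :: 'a"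
  have e: "?e \<in> C" by (simp add: tga_carrier_def)
  have H0: "0 \<in> H U" by (simp add: H_def)
  have "coset_sum U ?e 0 = (\<Sum>a\<in>{0}. ?e (a + 0) / \<beta> a 0)"
    by (rule coset_sum_superset) (use H0 in \<open>auto split: if_splits\<close>)
  then have "coset_sum U ?e 0 = 1" by simp
  then have "coset_sum U ?e 0 \<noteq> 0" by (simp only: one_neq_zero not_False_eq_True)
  then have "?e \<notin> NW U" unfolding NW_def by blast
  moreover have "NW U \<subseteq> C" by (auto simp: NW_def)
  ultimately have "NW U \<subset> C" using e by blast
  then have "\<not> dev_less 0 {I \<in> L. NW U \<subseteq> I}"
    unfolding dev_less.simps(1) using NW_L[of U] C_in_L by blast
  then show ?case by simp
next
  case (insert i V)
  define W where "W = U - insert i V"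
  have UV: "U - V = insert i W" using insert by (auto simp: W_def)
  have iW: "insert i W \<subseteq> U" "i \<notin> W" using insert by (auto simp: W_def)
  have WU: "W \<subseteq> U" using iW by blast
  define h where "h = (\<lambda>k. if k = i then \<omega> i else 0)"
  have hW: "h \<in> H (insert i W)" using iW U by (auto simp: H_def h_def Zn_def)
  then have hU: "h \<in> H U" and hG: "h \<in> G" using H_mono[OF iW(1)] by (auto simp: H_def)
  define t where "t f = lmul h f - f" for f
  have t_C: "t f \<in> C" if "f \<in> C" for f
    unfolding t_def using that lmul_in_C[OF that hG] ideal_diff[OF C_in_L] by blast
  have "\<not> dev_less (Suc (card V)) {I \<in> L. NW W \<subseteq> I}"
  proof (rule not_dev_less_step[OF NW_L NW_L NW_insert[OF iW] t_C])
    show "t (f + g) = t f + t g" for f g by (simp add: t_def lmul_def fun_eq_iff algebra_simps)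
    show "t (\<lambda>x. c * f x) = (\<lambda>x. c * t f x)" for c f by (simp add: t_def lmul_def fun_eq_iff algebra_simps)
    show "t (rmul p f) = rmul p (t f)" for p f by (simp add: t_def rmul_diff rmul_lmul)
    show "t f \<in> NW W" if f: "f \<in> NW W" for f
    proof -
      have fC: "f \<in> C" using f by (simp add: NW_def)
      have "coset_sum W (t f) g = 0" for g
        unfolding t_def coset_sum_diff[OF lmul_in_C[OF fC hG] fC] coset_sum_lmul[OF WU hU]
        using f by (simp add: NW_def)
      then show ?thesis using t_C[OF fC] by (simp add: NW_def)
    qed
    show "f \<in> NW W" if "f \<in> C" "t f \<in> NW W" for f
      using NW_regular[OF iW hU _ that(1)] that(2) by (simp add: t_def h_def)
    show "t f \<in> NW (insert i W)" if fC: "f \<in> C" for f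
    proof -
      have "coset_sum (insert i W) (t f) g = 0" for g
        unfolding t_def coset_sum_diff[OF lmul_in_C[OF fC hG] fC] coset_sum_lmul[OF iW(1) hU]
        using coset_sum_shift[OF iW(1) hW, of f g] by simp
      then show ?thesis using t_C[OF fC] by (simp add: NW_def)
    qed
    show "\<not> dev_less (card V) {I \<in> L. NW (insert i W) \<subseteq> I}" using insert UV by simp
  qed
  then show ?case using insert(1,2) by (simp add: W_def)
qed

lemma not_dev_less_lower: "\<not> dev_less (card U) L"
proof
  assume "dev_less (card U) L"
  then have "dev_less (card U) {I \<in> L. NW (U - U) \<subseteq> I}" by (rule dev_less_subset) auto
  then show False using not_dev_less_NW[of U] U finite_subset by blast
qed

end


section \<open>Change of basis\<close>

text \<open>Sending the basis element of \<open>a\<close> to \<open>c a\<close> times that of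
  \<open>\<phi> a\<close> is an algebra isomorphism \<open>\<Phi>\<close>, and taking images of
  right ideals is strictly monotone.\<close>

lemma dev_less_transfer:
  fixes \<tau> :: "'g::ab_group_add \<Rightarrow> 'g \<Rightarrow> 'a::field" and \<tau>' :: "'h::ab_group_add \<Rightarrow> 'h \<Rightarrow> 'a"
  assumes \<phi>: "\<And>a. a \<in> G \<Longrightarrow> \<phi> a \<in> G'" and \<psi>: "\<And>y. y \<in> G' \<Longrightarrow> \<psi> y \<in> G"
    and \<psi>\<phi>: "\<And>a. a \<in> G \<Longrightarrow> \<psi> (\<phi> a) = a" and \<phi>\<psi>: "\<And>y. y \<in> G' \<Longrightarrow> \<phi> (\<psi> y) = y"
    and G_add: "\<And>a b. a \<in> G \<Longrightarrow> b \<in> G \<Longrightarrow> a + b \<in> G"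
    and \<phi>_add: "\<And>a b. a \<in> G \<Longrightarrow> b \<in> G \<Longrightarrow> \<phi> (a + b) = \<phi> a + \<phi> b"
    and c: "\<And>a. a \<in> G \<Longrightarrow> c a \<noteq> 0"
    and \<tau>: "\<And>a b. a \<in> G \<Longrightarrow> b \<in> G \<Longrightarrow> \<tau> a b * c (a + b) = c a * c b * \<tau>' (\<phi> a) (\<phi> b)"
    and dev: "dev_less n (tga_right_ideals G' \<tau>')"
  shows "dev_less n (tga_right_ideals G \<tau>)"
proof -
  let ?C = "tga_carrier G :: ('g \<Rightarrow> 'a) set" and ?C' = "tga_carrier G' :: ('h \<Rightarrow> 'a) set"
  define \<Phi> :: "('g \<Rightarrow> 'a) \<Rightarrow> 'h \<Rightarrow> 'a" where "\<Phi> f = (\<lambda>y. if y \<in> G' then c (\<psi> y) * f (\<psi> y) else 0)" for f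
  define \<Psi> :: "('h \<Rightarrow> 'a) \<Rightarrow> 'g \<Rightarrow> 'a" where "\<Psi> r = (\<lambda>x. if x \<in> G then r (\<phi> x) / c x else 0)" for r
  have supp: "x \<in> G" if "f \<in> ?C" "f x \<noteq> 0" for f x using that by (auto simp: tga_carrier_def)
  have \<Phi>\<phi>: "\<Phi> f (\<phi> a) = c a * f a" if "a \<in> G" for f a using that \<phi> \<psi>\<phi> by (simp add: \<Phi>_def)
  have \<Phi>_nz: "y \<in> G' \<and> f (\<psi> y) \<noteq> 0" if "\<Phi> f y \<noteq> 0" for f y
    using that by (auto simp: \<Phi>_def split: if_splits)
  have \<Phi>_C: "\<Phi> f \<in> ?C'" if f: "f \<in> ?C" for f
  proof -
    have "{y. \<Phi> f y \<noteq> 0} \<subseteq> \<phi> ` {x. f x \<noteq> 0}"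
      using \<Phi>_nz \<phi>\<psi> by (force simp: image_iff)
    then show ?thesis using f \<Phi>_nz unfolding tga_carrier_def by (auto intro: finite_subset)
  qed
  have \<Psi>_C: "\<Psi> r \<in> ?C" if r: "r \<in> ?C'" for r
  proof -
    have "{x. \<Psi> r x \<noteq> 0} \<subseteq> \<psi> ` {y. r y \<noteq> 0}"
    proof
      fix x assume "x \<in> {x. \<Psi> r x \<noteq> 0}"
      then have "x \<in> G" "r (\<phi> x) \<noteq> 0" by (auto simp: \<Psi>_def split: if_splits)
      then show "x \<in> \<psi> ` {y. r y \<noteq> 0}" using \<psi>\<phi>[of x] by (intro image_eqI[of _ _ "\<phi> x"]) auto
    qed
    then show ?thesis using r unfolding tga_carrier_def
      by (auto intro: finite_subset simp: \<Psi>_def split: if_splits)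
  qed
  have \<Phi>\<Psi>: "\<Phi> (\<Psi> r) = r" if "r \<in> ?C'" for r
  proof
    fix y
    show "\<Phi> (\<Psi> r) y = r y"
      using that \<psi> \<phi>\<psi> c[of "\<psi> y"] by (cases "y \<in> G'") (auto simp: \<Phi>_def \<Psi>_def tga_carrier_def)
  qed
  have \<Phi>_inj: "f = g" if "f \<in> ?C" "g \<in> ?C" "\<Phi> f = \<Phi> g" for f g
  proof
    fix x
    show "f x = g x"
    proof (cases "x \<in> G")
      case True
      then show ?thesis using fun_cong[OF that(3), of "\<phi> x"] \<Phi>\<phi> c by simp
    next
      case False
      then show ?thesis using supp[OF that(1), of x] supp[OF that(2), of x] by metis
    qed
  qed
  have \<Phi>_mult: "\<Phi> (tga_mult \<tau> f g) = tga_mult \<tau>' (\<Phi> f) (\<Phi> g)" if f: "f \<in> ?C" and g: "g \<in> ?C" for f g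
  proof
    fix y
    let ?S' = "{(a, b). \<Phi> f a \<noteq> 0 \<and> \<Phi> g b \<noteq> 0 \<and> a + b = y}"
    let ?S = "{(a, b). f a \<noteq> 0 \<and> g b \<noteq> 0 \<and> a + b = \<psi> y}"
    show "\<Phi> (tga_mult \<tau> f g) y = tga_mult \<tau>' (\<Phi> f) (\<Phi> g) y"
    proof (cases "y \<in> G'")
      case False
      have "?S' = {}"
      proof -
        have "a + b \<in> G'" if "\<Phi> f a \<noteq> 0" "\<Phi> g b \<noteq> 0" for a b
          using \<phi>[OF G_add[OF \<psi> \<psi>]] \<phi>_add[OF \<psi> \<psi>] \<phi>\<psi> \<Phi>_nz[OF that(1)] \<Phi>_nz[OF that(2)] by metis
        then show ?thesis using False by auto
      qed
      then have "tga_mult \<tau>' (\<Phi> f) (\<Phi> g) y = 0" unfolding tga_mult_def by (simp only: sum.empty)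
      then show ?thesis using False by (simp add: \<Phi>_def)
    next
      case True
      have "\<Phi> (tga_mult \<tau> f g) y = (\<Sum>(a, b)\<in>?S. c (\<psi> y) * (f a * g b * \<tau> a b))"
        using True by (simp add: \<Phi>_def tga_mult_def sum_distrib_left case_prod_unfold)
      also have "\<dots> = (\<Sum>(a, b)\<in>?S'. \<Phi> f a * \<Phi> g b * \<tau>' a b)"
      proof (rule sum.reindex_bij_witness[where i = "\<lambda>(a, b). (\<psi> a, \<psi> b)" and j = "\<lambda>(a, b). (\<phi> a, \<phi> b)"], goal_cases)
        case (1 p)
        then show ?case using supp f g \<psi>\<phi> by auto
      next
        case (2 p)
        then obtain a b where p: "p = (a, b)" "f a \<noteq> 0" "g b \<noteq> 0" "a + b = \<psi> y" by auto
        then have "a \<in> G" "b \<in> G" using supp f g by auto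
        then show ?case using p \<Phi>\<phi> c \<phi>_add[of a b] \<phi>\<psi>[OF True] by auto
      next
        case (3 p)
        then show ?case using \<Phi>_nz \<phi>\<psi> by force
      next
        case (4 p)
        then obtain a b where p: "p = (a, b)" "\<Phi> f a \<noteq> 0" "\<Phi> g b \<noteq> 0" "a + b = y" by auto
        have ab: "a \<in> G'" "b \<in> G'" using \<Phi>_nz p by blast+
        have "\<phi> (\<psi> a + \<psi> b) = y" using \<phi>_add[OF \<psi>[OF ab(1)] \<psi>[OF ab(2)]] \<phi>\<psi> ab p(4) by simp
        then have "\<psi> a + \<psi> b = \<psi> y" using \<psi>\<phi>[OF G_add[OF \<psi>[OF ab(1)] \<psi>[OF ab(2)]]] by simp
        then show ?case using p \<Phi>_nz by auto
      next
        case (5 p)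
        then obtain a b where p: "p = (a, b)" "f a \<noteq> 0" "g b \<noteq> 0" "a + b = \<psi> y" by auto
        then have ab: "a \<in> G" "b \<in> G" using supp f g by auto
        have "\<Phi> f (\<phi> a) * \<Phi> g (\<phi> b) * \<tau>' (\<phi> a) (\<phi> b) = f a * g b * (c a * c b * \<tau>' (\<phi> a) (\<phi> b))"
          using ab by (simp add: \<Phi>\<phi>)
        also have "\<dots> = c (\<psi> y) * (f a * g b * \<tau> a b)"
          using \<tau>[OF ab] p(4) by (simp add: mult.commute mult.left_commute)
        finally show ?case using p(1) by simp
      qed
      finally show ?thesis by (simp add: tga_mult_def)
    qed
  qed
  have \<Phi>_add: "\<Phi> (f + g) = \<Phi> f + \<Phi> g" and \<Phi>_minus: "\<Phi> (- f) = - \<Phi> f" and \<Phi>_0: "\<Phi> 0 = 0" for f g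
    by (auto simp: \<Phi>_def fun_eq_iff algebra_simps)
  show ?thesis
  proof (rule dev_less_strict_embedding[OF dev, where \<phi> = "\<lambda>I. \<Phi> ` I"])
    fix I assume I: "I \<in> tga_right_ideals G \<tau>"
    then have IC: "I \<subseteq> ?C" and I_add: "\<And>f g. f \<in> I \<Longrightarrow> g \<in> I \<Longrightarrow> f + g \<in> I"
      and I_minus: "\<And>f. f \<in> I \<Longrightarrow> - f \<in> I"
      and I_mult: "\<And>f r. f \<in> I \<Longrightarrow> r \<in> ?C \<Longrightarrow> tga_mult \<tau> f r \<in> I"
      unfolding tga_right_ideals_def by blast+
    show "\<Phi> ` I \<in> tga_right_ideals G' \<tau>'"
      unfolding tga_right_ideals_def mem_Collect_eq
    proof (intro conjI ballI)
      show "\<Phi> ` I \<subseteq> ?C'" using IC \<Phi>_C by blast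
      show "0 \<in> \<Phi> ` I" using I \<Phi>_0 by (force simp: tga_right_ideals_def)
      fix u assume "u \<in> \<Phi> ` I"
      then obtain f where f: "u = \<Phi> f" "f \<in> I" by blast
      show "- u \<in> \<Phi> ` I"
        unfolding f(1) \<Phi>_minus[symmetric] using I_minus[OF f(2)] by (rule imageI)
      show "tga_mult \<tau>' u r \<in> \<Phi> ` I" if r: "r \<in> ?C'" for r
      proof -
        have "tga_mult \<tau>' u r = \<Phi> (tga_mult \<tau> f (\<Psi> r))"
          using \<Phi>_mult[OF subsetD[OF IC f(2)] \<Psi>_C[OF r]] \<Phi>\<Psi>[OF r] f(1) by metis
        then show ?thesis using I_mult[OF f(2) \<Psi>_C[OF r]] by blast
      qed
      fix v assume "v \<in> \<Phi> ` I"
      then obtain g where g: "v = \<Phi> g" "g \<in> I" by blast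
      show "u + v \<in> \<Phi> ` I"
        unfolding f(1) g(1) \<Phi>_add[symmetric] using I_add[OF f(2) g(2)] by (rule imageI)
    qed
    fix J assume J: "J \<in> tga_right_ideals G \<tau>" and IJ: "I \<subset> J"
    then have JC: "J \<subseteq> ?C" by (simp add: tga_right_ideals_def)
    obtain x where x: "x \<in> J" "x \<notin> I" using IJ by blast
    have "\<Phi> x \<notin> \<Phi> ` I"
    proof
      assume "\<Phi> x \<in> \<Phi> ` I"
      then obtain z where z: "z \<in> I" "\<Phi> x = \<Phi> z" by blast
      have "x = z" by (rule \<Phi>_inj) (use x z IC JC in auto)
      then show False using x z by blast
    qed
    then show "\<Phi> ` I \<subset> \<Phi> ` J" using IJ x(1) by blast
  qed
qed

lemma tga_krull_dim_transfer:
  fixes \<tau> :: "'g::ab_group_add \<Rightarrow> 'g \<Rightarrow> 'a::field" and \<tau>' :: "'h::ab_group_add \<Rightarrow> 'h \<Rightarrow> 'a"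
  assumes \<phi>: "\<And>a. a \<in> G \<Longrightarrow> \<phi> a \<in> G'" and \<psi>: "\<And>y. y \<in> G' \<Longrightarrow> \<psi> y \<in> G"
    and \<psi>\<phi>: "\<And>a. a \<in> G \<Longrightarrow> \<psi> (\<phi> a) = a" and \<phi>\<psi>: "\<And>y. y \<in> G' \<Longrightarrow> \<phi> (\<psi> y) = y"
    and G_add: "\<And>a b. a \<in> G \<Longrightarrow> b \<in> G \<Longrightarrow> a + b \<in> G"
    and \<phi>_add: "\<And>a b. a \<in> G \<Longrightarrow> b \<in> G \<Longrightarrow> \<phi> (a + b) = \<phi> a + \<phi> b"
    and c: "\<And>a. a \<in> G \<Longrightarrow> c a \<noteq> 0"
    and \<tau>: "\<And>a b. a \<in> G \<Longrightarrow> b \<in> G \<Longrightarrow> \<tau> a b * c (a + b) = c a * c b * \<tau>' (\<phi> a) (\<phi> b)"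
  shows "tga_krull_dim G \<tau> = tga_krull_dim G' \<tau>'"
proof -
  have G'_add: "x + y \<in> G'" and \<psi>_add: "\<psi> (x + y) = \<psi> x + \<psi> y" if "x \<in> G'" "y \<in> G'" for x y
  proof -
    have *: "x + y = \<phi> (\<psi> x + \<psi> y)" using \<phi>_add[OF \<psi> \<psi>] \<phi>\<psi> that by simp
    show "x + y \<in> G'" unfolding * using \<phi> G_add \<psi> that by blast
    show "\<psi> (x + y) = \<psi> x + \<psi> y" unfolding * using \<psi>\<phi> G_add \<psi> that by blast
  qed
  have \<tau>': "\<tau>' x y * inverse (c (\<psi> (x + y))) = inverse (c (\<psi> x)) * inverse (c (\<psi> y)) * \<tau> (\<psi> x) (\<psi> y)"
    if "x \<in> G'" "y \<in> G'" for x y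
  proof -
    have "c (\<psi> (x + y)) \<noteq> 0" "c (\<psi> x) \<noteq> 0" "c (\<psi> y) \<noteq> 0" using c \<psi> G'_add that by blast+
    then show ?thesis
      using \<tau>[OF \<psi>[OF that(1)] \<psi>[OF that(2)]] \<phi>\<psi> that by (simp add: \<psi>_add field_simps)
  qed
  have "dev_less n (tga_right_ideals G \<tau>) \<longleftrightarrow> dev_less n (tga_right_ideals G' \<tau>')" for n
  proof
    show "dev_less n (tga_right_ideals G \<tau>)" if "dev_less n (tga_right_ideals G' \<tau>')"
      by (rule dev_less_transfer[where \<phi> = \<phi> and \<psi> = \<psi> and c = c and G' = G' and \<tau>' = \<tau>']) (fact assms that)+
    show "dev_less n (tga_right_ideals G' \<tau>')" if "dev_less n (tga_right_ideals G \<tau>)"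
      by (rule dev_less_transfer[where \<phi> = \<psi> and \<psi> = \<phi> and G' = G and \<tau>' = \<tau>
          and c = "\<lambda>y. inverse (c (\<psi> y))"])
        (use \<phi> \<psi> \<phi>\<psi> \<psi>\<phi> G'_add \<psi>_add c \<tau>' that in \<open>auto simp del: dev_less.simps\<close>)
  qed
  then show ?thesis unfolding tga_krull_dim_def by (rule poset_krull_dim_cong)
qed

section \<open>Cocycles on the rank two lattice\<close>

lemma int_hom_powi:
  fixes \<chi> :: "int \<Rightarrow> 'a::field"
  assumes add: "\<And>i j. \<chi> (i + j) = \<chi> i * \<chi> j" and nz: "\<And>i. \<chi> i \<noteq> 0"
  shows "\<chi> i = \<chi> 1 powi i"
proof (induction i rule: int_induct[where k = 0])
  case base
  show ?case using add[of 0 0] nz[of 0] by simp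
next
  case (step1 i)
  then show ?case using add[of i 1] nz[of 1] by (simp add: power_int_add)
next
  case (step2 i)
  have "\<chi> (i - 1) * \<chi> 1 = \<chi> i" using add[of "i - 1" 1] by simp
  then show ?case using step2 nz[of 1] by (simp add: power_int_diff field_simps)
qed

text \<open>In the central extension formed by homogeneous units, the section \<open>X^i Y^j\<close>
  has as its cocycle only the cost of moving powers of \<open>Y\<close> past powers of
  \<open>X\<close>. The scalars of this section give the change of basis \<open>c\<close>.\<close>

lemma cocycle_normal_form:
  fixes tau :: "int \<times> int \<Rightarrow> int \<times> int \<Rightarrow> 'a::field"
  assumes "is_cocycle UNIV tau"
  shows "\<exists>q c. q \<noteq> 0 \<and> (\<forall>a. c a \<noteq> 0) \<and>
    (\<forall>a b. tau a b * c (a + b) = c a * c b * q powi (snd a * fst b))"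
proof -
  have nz [simp]: "tau a b \<noteq> 0" for a b using assms unfolding is_cocycle_def by blast
  have coc: "tau a b * tau (a + b) c = tau b c * tau a (b + c)" for a b c
    using assms unfolding is_cocycle_def by blast
  \<comment> \<open>The commutator pairing of the extension; it is a bicharacter although
    \<open>tau\<close> need not be one.\<close>
  define \<kappa> where "\<kappa> a b = tau a b / tau b a" for a b
  have \<kappa>_left: "\<kappa> (a + b) d = \<kappa> a d * \<kappa> b d" for a b d
  proof -
    have 1: "tau (a + b) d = tau b d * tau a (b + d) / tau a b" using coc[of a b d] by (simp add: field_simps)
    have 2: "tau d (a + b) = tau d a * tau (a + d) b / tau a b"
      using coc[of d a b] by (simp add: field_simps add.commute)
    have 3: "tau (a + d) b = tau d b * tau a (b + d) / tau a d"
      using coc[of a d b] by (simp add: field_simps add.commute)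
    show ?thesis unfolding \<kappa>_def 1 2 3 by simp
  qed
  have \<kappa>_right: "\<kappa> d (a + b) = \<kappa> d a * \<kappa> d b" for a b d
    using \<kappa>_left[of a b d] by (simp add: \<kappa>_def field_simps)
  define q where "q = \<kappa> (0, 1) (1, 0)"
  have \<kappa>_q: "\<kappa> (0, j) (i, 0) = q powi (j * i)" for i j
  proof -
    have \<kappa>_nz: "\<kappa> a b \<noteq> 0" for a b by (simp add: \<kappa>_def)
    have "\<kappa> (0, j) (i + i', 0) = \<kappa> (0, j) (i, 0) * \<kappa> (0, j) (i', 0)" for i i'
      using \<kappa>_right[of "(0, j)" "(i, 0)" "(i', 0)"] by (simp add: plus_prod_def)
    then have "\<kappa> (0, j) (i, 0) = \<kappa> (0, j) (1, 0) powi i"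
      using int_hom_powi[of "\<lambda>i. \<kappa> (0, j) (i, 0)"] \<kappa>_nz by blast
    moreover have "\<kappa> (0, j + j') (1, 0) = \<kappa> (0, j) (1, 0) * \<kappa> (0, j') (1, 0)" for j j'
      using \<kappa>_left[of "(0, j)" "(0, j')" "(1, 0)"] by (simp add: plus_prod_def)
    then have "\<kappa> (0, j) (1, 0) = q powi j"
      using int_hom_powi[of "\<lambda>j. \<kappa> (0, j) (1, 0)"] \<kappa>_nz unfolding q_def by blast
    ultimately show ?thesis by (simp add: power_int_mult)
  qed
  \<comment> \<open>The group of homogeneous units of the twisted group algebra.\<close>
  define E where "E = \<lparr>carrier = {(u :: 'a, a :: int \<times> int). u \<noteq> 0},
    mult = (\<lambda>(u, a) (v, b). (u * v * tau a b, a + b)), one = (1 / tau 0 0, 0 :: int \<times> int)\<rparr>"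
  \<comment> \<open>As \<open>tau\<close> need not be normalised, the neutral element carries the
    scalar \<open>1 / tau 0 0\<close>.\<close>
  have tau0: "tau 0 b = tau 0 0" for b using coc[of 0 0 b] by simp
  have mE: "x \<otimes>\<^bsub>E\<^esub> y = (fst x * fst y * tau (snd x) (snd y), snd x + snd y)" for x y
    by (simp add: E_def case_prod_unfold)
  have cE: "x \<in> carrier E \<longleftrightarrow> fst x \<noteq> 0" for x by (simp add: E_def case_prod_unfold)
  have oE: "\<one>\<^bsub>E\<^esub> = (1 / tau 0 0, 0)" by (simp add: E_def)
  interpret E: group E
  proof (rule groupI)
    show "x \<otimes>\<^bsub>E\<^esub> y \<in> carrier E" if "x \<in> carrier E" "y \<in> carrier E" for x y using that by (simp add: mE cE)
    show "\<one>\<^bsub>E\<^esub> \<in> carrier E" by (simp add: oE cE)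
    show "x \<otimes>\<^bsub>E\<^esub> y \<otimes>\<^bsub>E\<^esub> z = x \<otimes>\<^bsub>E\<^esub> (y \<otimes>\<^bsub>E\<^esub> z)" for x y z
    proof -
      have "fst x * fst y * tau (snd x) (snd y) * fst z * tau (snd x + snd y) (snd z)
          = fst x * fst y * fst z * (tau (snd x) (snd y) * tau (snd x + snd y) (snd z))" by simp
      then show ?thesis unfolding mE fst_conv snd_conv coc by (simp add: algebra_simps)
    qed
    show "\<one>\<^bsub>E\<^esub> \<otimes>\<^bsub>E\<^esub> x = x" for x by (simp add: mE oE tau0[of "snd x"])
    show "\<exists>y\<in>carrier E. y \<otimes>\<^bsub>E\<^esub> x = \<one>\<^bsub>E\<^esub>" if "x \<in> carrier E" for x
      by (rule bexI[of _ "(1 / (fst x * tau (- snd x) (snd x) * tau 0 0), - snd x)"])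
        (use that in \<open>auto simp: mE oE cE\<close>)
  qed
  define X Y where "X = (1 :: 'a, (1 :: int, 0 :: int))" and "Y = (1 :: 'a, (0 :: int, 1 :: int))"
  have XY: "X \<in> carrier E" "Y \<in> carrier E" by (simp_all add: X_def Y_def cE)
  have snd_pow: "snd (x [^]\<^bsub>E\<^esub> i) = (i * fst (snd x), i * snd (snd x))" if x: "x \<in> carrier E" for x and i :: int
  proof (induction i rule: int_induct[where k = 0])
    case base
    show ?case by (simp add: oE zero_prod_def)
  next
    case (step1 i)
    have "x [^]\<^bsub>E\<^esub> (i + 1) = x [^]\<^bsub>E\<^esub> i \<otimes>\<^bsub>E\<^esub> x" using E.int_pow_mult[OF x, of i 1] x by (simp add: E.int_pow_1)
    then show ?case using step1 by (simp add: mE plus_prod_def algebra_simps)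
  next
    case (step2 i)
    have "x [^]\<^bsub>E\<^esub> i = x [^]\<^bsub>E\<^esub> (i - 1) \<otimes>\<^bsub>E\<^esub> x" using E.int_pow_mult[OF x, of "i - 1" 1] x by (simp add: E.int_pow_1)
    then have "snd (x [^]\<^bsub>E\<^esub> (i - 1)) = snd (x [^]\<^bsub>E\<^esub> i) - snd x" by (simp add: mE)
    then show ?case using step2 by (simp add: minus_prod_def algebra_simps)
  qed
  define s where "s a = X [^]\<^bsub>E\<^esub> fst a \<otimes>\<^bsub>E\<^esub> Y [^]\<^bsub>E\<^esub> snd a" for a :: "int \<times> int"
  have sE: "s a \<in> carrier E" for a using XY by (simp add: s_def)
  have snd_s: "snd (s a) = a" for a
    by (simp add: s_def mE snd_pow[OF XY(1)] snd_pow[OF XY(2)]) (simp add: X_def Y_def plus_prod_def)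
  have s_mult: "fst (s a \<otimes>\<^bsub>E\<^esub> s b) = q powi (snd a * fst b) * fst (s (a + b))" for a b
  proof -
    let ?x = "X [^]\<^bsub>E\<^esub> fst a" and ?y = "Y [^]\<^bsub>E\<^esub> snd a" and ?x' = "X [^]\<^bsub>E\<^esub> fst b" and ?y' = "Y [^]\<^bsub>E\<^esub> snd b"
    let ?k = "q powi (snd a * fst b)"
    have cl: "?x \<in> carrier E" "?y \<in> carrier E" "?x' \<in> carrier E" "?y' \<in> carrier E" using XY by auto
    have "snd ?y = (0, snd a)" "snd ?x' = (fst b, 0)"
      unfolding snd_pow[OF XY(1)] snd_pow[OF XY(2)] by (simp_all add: X_def Y_def)
    then have comm: "?y \<otimes>\<^bsub>E\<^esub> ?x' = (?k * fst (?x' \<otimes>\<^bsub>E\<^esub> ?y), snd (?x' \<otimes>\<^bsub>E\<^esub> ?y))"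
      using \<kappa>_q[of "snd a" "fst b"] by (simp add: mE \<kappa>_def field_simps)
    have "s a \<otimes>\<^bsub>E\<^esub> s b = ?x \<otimes>\<^bsub>E\<^esub> ((?y \<otimes>\<^bsub>E\<^esub> ?x') \<otimes>\<^bsub>E\<^esub> ?y')"
      using cl by (simp add: s_def E.m_assoc)
    also have "fst \<dots> = ?k * fst (?x \<otimes>\<^bsub>E\<^esub> ((?x' \<otimes>\<^bsub>E\<^esub> ?y) \<otimes>\<^bsub>E\<^esub> ?y'))"
      unfolding comm by (simp add: mE mult.assoc mult.left_commute)
    also have "?x \<otimes>\<^bsub>E\<^esub> ((?x' \<otimes>\<^bsub>E\<^esub> ?y) \<otimes>\<^bsub>E\<^esub> ?y') = (?x \<otimes>\<^bsub>E\<^esub> ?x') \<otimes>\<^bsub>E\<^esub> (?y \<otimes>\<^bsub>E\<^esub> ?y')"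
      using cl by (simp add: E.m_assoc)
    also have "\<dots> = s (a + b)" using XY by (simp add: s_def E.int_pow_mult)
    finally show ?thesis .
  qed
  have nz_s: "fst (s a) \<noteq> 0" for a using sE by (simp add: cE)
  have "tau a b * inverse (fst (s (a + b))) = inverse (fst (s a)) * inverse (fst (s b)) * q powi (snd a * fst b)" for a b
    using s_mult[of a b] nz_s[of a] nz_s[of b] nz_s[of "a + b"] by (simp add: mE snd_s field_simps)
  moreover have "q \<noteq> 0" by (simp add: q_def \<kappa>_def)
  ultimately show ?thesis
    using nz_s by (intro exI[of _ q] exI[of _ "\<lambda>a. inverse (fst (s a))"]) auto
qed

section \<open>Krull dimension of products of quantum planes\<close>

text \<open>Coordinates \<open>2 * j\<close> and \<open>2 * j + 1\<close> are the exponents of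
  generators \<open>x\<close> and \<open>y\<close> of the plane \<open>j\<close>, with
  \<open>y x = q x y\<close>.\<close>

definition qform :: "nat \<Rightarrow> (nat \<Rightarrow> 'a::field) \<Rightarrow> (nat \<Rightarrow> int) \<Rightarrow> (nat \<Rightarrow> int) \<Rightarrow> 'a" where
  "qform s q a b = (\<Prod>j<s. q j powi (a (2 * j + 1) * b (2 * j)))"

definition torsion :: "'a::field \<Rightarrow> bool" where
  "torsion q \<longleftrightarrow> (\<exists>N>0. q ^ N = 1)"

lemma powi_inject_not_torsion:
  fixes q :: "'a::field"
  assumes "q \<noteq> 0" "\<not> torsion q" shows "q powi i = q powi j \<longleftrightarrow> i = j"
proof -
  have aux: "i \<le> j" if eq: "q powi i = q powi j" for i j
  proof (rule ccontr)
    assume "\<not> i \<le> j"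
    then have pos: "0 < nat (i - j)" by simp
    have "q powi (i - j) = 1" using eq assms(1) by (simp add: power_int_diff)
    then have "q ^ nat (i - j) = 1" using pos by (simp add: power_int_def split: if_splits)
    then show False using assms(2) pos unfolding torsion_def by blast
  qed
  show ?thesis using aux[of i j] aux[of j i] by auto
qed

lemma tga_krull_dim_qform:
  fixes q :: "nat \<Rightarrow> 'a::field"
  assumes q: "\<And>j. j < s \<Longrightarrow> q j \<noteq> 0"
  shows "tga_krull_dim (Zn (2 * s)) (qform s q) = enat (\<Sum>j<s. if torsion (q j) then 2 else 1)"
proof -
  interpret bichar_torus "2 * s" "qform s q"
  proof
    show "qform s q (a + b) c = qform s q a c * qform s q b c" for a b c
      unfolding qform_def prod.distrib[symmetric]
      by (rule prod.cong) (simp_all add: q power_int_add distrib_right)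
    show "qform s q a (b + c) = qform s q a b * qform s q a c" for a b c
      unfolding qform_def prod.distrib[symmetric]
      by (rule prod.cong) (simp_all add: q power_int_add distrib_left)
    show "qform s q a b \<noteq> 0" for a b
      using q by (simp add: qform_def)
  qed
  define A where "A = {j. j < s \<and> \<not> torsion (q j)}"
  \<comment> \<open>Both coordinates of every plane with \<open>q j\<close> of infinite order; the
    upper bound is applied with \<open>m = card A\<close>.\<close>
  define T where "T = (\<lambda>j. 2 * j) ` A \<union> (\<lambda>j. 2 * j + 1) ` A"
  \<comment> \<open>From a plane with \<open>q j\<close> of infinite order only \<open>x\<close> is
    kept, so the lower bound is also \<open>2 * s - card A\<close>.\<close>
  define U where "U = {..<2 * s} - (\<lambda>j. 2 * j + 1) ` A"
  have finA: "finite A" by (simp add: A_def)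
  have card_odd: "card ((\<lambda>j. 2 * j + 1) ` A) = card A" by (rule card_image) (simp add: inj_on_def)
  have "card ((\<lambda>j. 2 * j) ` A) = card A" by (rule card_image) (simp add: inj_on_def)
  moreover have "(\<lambda>j. 2 * j) ` A \<inter> (\<lambda>j. 2 * j + 1) ` A = {}" by (auto, presburger)
  ultimately have cardT: "card T = 2 * card A" using finA card_odd by (simp add: T_def card_Un_disjoint)
  have TU: "T \<subseteq> {..<2 * s}" by (auto simp: T_def A_def)
  have cardU: "card U = 2 * s - card A"
    unfolding U_def by (subst card_Diff_subset) (use finA card_odd in \<open>auto simp: A_def\<close>)
  \<comment> \<open>The commutation factor of each generator of a plane depends only on the exponent
    of the other one.\<close>
  have odd_left: "qform s q (unit_vec (2 * j + 1)) p = q j powi p (2 * j)" if "j < s" for j p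
  proof -
    have "qform s q (unit_vec (2 * j + 1)) p = (\<Prod>k<s. if k = j then q j powi p (2 * j) else 1)"
      unfolding qform_def by (rule prod.cong) (auto simp: unit_vec_def)
    then show ?thesis using that by simp
  qed
  have odd_right: "qform s q p (unit_vec (2 * j + 1)) = 1" for j p
    unfolding qform_def by (rule prod.neutral) (auto simp: unit_vec_def, presburger)
  have even_left: "qform s q (unit_vec (2 * j)) p = 1" for j p
    unfolding qform_def by (rule prod.neutral) (auto simp: unit_vec_def, presburger)
  have even_right: "qform s q p (unit_vec (2 * j)) = q j powi p (2 * j + 1)" if "j < s" for j p
  proof -
    have "qform s q p (unit_vec (2 * j)) = (\<Prod>k<s. if k = j then q j powi p (2 * j + 1) else 1)"
      unfolding qform_def by (rule prod.cong) (auto simp: unit_vec_def)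
    then show ?thesis using that by simp
  qed
  have "separated i" if "i \<in> T" for i
  proof -
    from that obtain j where j: "j < s" "\<not> torsion (q j)" and i: "i = 2 * j \<or> i = 2 * j + 1"
      by (auto simp: T_def A_def)
    note inj = powi_inject_not_torsion[OF q[OF j(1)] j(2)]
    from i show ?thesis
    proof
      assume i: "i = 2 * j"
      show ?thesis unfolding separated_def i
        by (rule exI[of _ "2 * j + 1"])
          (use j(1) in \<open>simp only: odd_left[OF j(1)] odd_right inj div_by_1, simp\<close>)
    next
      assume i: "i = 2 * j + 1"
      show ?thesis unfolding separated_def i
        by (rule exI[of _ "2 * j"])
          (use j(1) in \<open>simp add: even_left even_right[OF j(1)] inj divide_inverse\<close>)
    qed
  qed
  then have upper: "dev_less (Suc (2 * s - card A)) L" using dev_less_upper[OF TU _ cardT] by blast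
  have "\<forall>j. \<exists>N. torsion (q j) \<longrightarrow> 0 < N \<and> q j ^ N = 1" unfolding torsion_def by blast
  then obtain N where N: "\<And>j. torsion (q j) \<Longrightarrow> 0 < N j \<and> q j ^ N j = 1" by metis
  \<comment> \<open>If \<open>q j\<close> is a root of unity, a power of \<open>y\<close> with
    \<open>q j ^ N j = 1\<close> commutes with \<open>x\<close>.\<close>
  define \<omega> where "\<omega> i = (if even i then 1 else int (N (i div 2)))" for i
  interpret commutative_subtorus "2 * s" "qform s q" U \<omega>
    "\<lambda>W. {a \<in> Zn (2 * s). \<forall>i. (i \<in> W \<longrightarrow> \<omega> i dvd a i) \<and> (i \<notin> W \<longrightarrow> a i = 0)}"
  proof (unfold_locales, goal_cases)
    case 1
    show ?case by (auto simp: U_def)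
  next
    case (2 i)
    have "torsion (q (i div 2))" if "odd i"
    proof -
      have "i = 2 * (i div 2) + 1" using that by simp
      moreover have "i div 2 < s" using 2 that by (auto simp: U_def)
      ultimately show ?thesis using 2 unfolding U_def A_def by blast
    qed
    then show ?case using N by (auto simp: \<omega>_def)
  next
    case (3 a b)
    show ?case unfolding qform_def
    proof (rule prod.neutral, rule ballI)
      fix j assume j: "j \<in> {..<s}"
      show "q j powi (a (2 * j + 1) * b (2 * j)) = 1"
      proof (cases "torsion (q j)")
        case True
        have "\<omega> (2 * j + 1) dvd a (2 * j + 1)" using 3(1) by (cases "2 * j + 1 \<in> U") auto
        then have "int (N j) dvd a (2 * j + 1)" by (simp add: \<omega>_def)
        then obtain z where "a (2 * j + 1) = int (N j) * z" by blast
        then have "q j powi (a (2 * j + 1) * b (2 * j)) = (q j powi int (N j)) powi (z * b (2 * j))"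
          by (simp only: power_int_mult[symmetric] mult.assoc)
        then show ?thesis using N[OF True] by simp
      next
        case False
        then have "2 * j + 1 \<notin> U" using j by (auto simp: U_def A_def)
        then show ?thesis using 3(1) by simp
      qed
    qed
  qed
  have lower: "\<not> dev_less (2 * s - card A) L" using not_dev_less_lower cardU by simp
  have "(\<Sum>j<s. if torsion (q j) then 2 else 1) + card A
      = (\<Sum>j<s. (if torsion (q j) then 2 else 1) + (if torsion (q j) then 0 else 1))"
    unfolding sum.distrib A_def
    by (simp add: sum.If_cases card_eq_sum[symmetric] Collect_conj_eq lessThan_def Int_commute)
       (simp add: Collect_neg_eq)
  also have "\<dots> = (\<Sum>j<s. 2)" by (rule sum.cong) auto
  finally have "2 * s - card A = (\<Sum>j<s. if torsion (q j) then 2 else 1)" by simp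
  then show ?thesis
    unfolding tga_krull_dim_def using poset_krull_dim_eqI[OF upper lower] by simp
qed

lemma enat_sum: "enat (\<Sum>j<s. f j) = (\<Sum>j<s. enat (f j))" for s :: nat
  by (induction s) (simp_all add: zero_enat_def flip: plus_enat_simps(1))

theorem corollary5p13:
  fixes tau :: "nat \<Rightarrow> (int \<times> int) \<Rightarrow> (int \<times> int) \<Rightarrow> 'a::field" and s :: nat
  assumes "\<forall>j<s. is_cocycle (UNIV :: (int \<times> int) set) (tau j)"
  shows "tga_krull_dim (Zpow2 s) (prod_cocycle s tau) = (\<Sum>j<s. tga_krull_dim UNIV (tau j))"
proof -
  have "\<forall>j. \<exists>q c. j < s \<longrightarrow> q \<noteq> 0 \<and> (\<forall>a. c a \<noteq> 0) \<and>
    (\<forall>a b. tau j a b * c (a + b) = c a * c b * q powi (snd a * fst b))"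
    using assms cocycle_normal_form by blast
  then obtain q c where q: "\<And>j. j < s \<Longrightarrow> q j \<noteq> 0"
    and c: "\<And>j a. j < s \<Longrightarrow> c j a \<noteq> 0"
    and norm: "\<And>j a b. j < s \<Longrightarrow> tau j a b * c j (a + b) = c j a * c j b * q j powi (snd a * fst b)"
    by metis
  \<comment> \<open>The pairs are interleaved into \<open>2 * s\<close> coordinates, and the
    rescalings of the factors multiply.\<close>
  have "tga_krull_dim (Zpow2 s) (prod_cocycle s tau) = tga_krull_dim (Zn (2 * s)) (qform s q)"
  proof (rule tga_krull_dim_transfer[where
        \<phi> = "\<lambda>x i. if even i then fst (x (i div 2)) else snd (x (i div 2))"
        and \<psi> = "\<lambda>y j. (y (2 * j), y (2 * j + 1))" and c = "\<lambda>x. \<Prod>j<s. c j (x j)"], goal_cases)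
    case (8 a b)
    then show ?case using norm by (simp add: prod_cocycle_def qform_def flip: prod.distrib)
  qed (use c in \<open>auto simp: Zpow2_def Zn_def fun_eq_iff zero_prod_def\<close>)
  also have "\<dots> = enat (\<Sum>j<s. if torsion (q j) then 2 else 1)" using q by (rule tga_krull_dim_qform)
  also have "\<dots> = (\<Sum>j<s. enat (if torsion (q j) then 2 else 1))"
    by (rule enat_sum)
  also have "\<dots> = (\<Sum>j<s. tga_krull_dim UNIV (tau j))"
  proof (rule sum.cong)
    fix j assume "j \<in> {..<s}"
    then have j: "j < s" by simp
    \<comment> \<open>A single factor is the case of one plane, so the same formula evaluates
      it.\<close>
    have "tga_krull_dim UNIV (tau j) = tga_krull_dim (Zn (2 * 1)) (qform 1 (\<lambda>_. q j))"
    proof (rule tga_krull_dim_transfer[where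
          \<phi> = "\<lambda>a i. if i = 0 then fst a else if i = 1 then snd a else 0"
          and \<psi> = "\<lambda>y. (y 0, y 1)" and c = "c j"], goal_cases)
      case (8 a b)
      then show ?case using norm[OF j] by (simp add: qform_def)
    next
      case (4 y)
      have "y i = 0" if "i \<noteq> 0" "i \<noteq> 1" for i using 4 that by (simp add: Zn_def)
      then show ?case by (auto simp: fun_eq_iff)
    qed (use c[OF j] in \<open>auto simp: Zn_def fun_eq_iff\<close>)
    also have "\<dots> = enat (\<Sum>i<1::nat. if torsion (q j) then 2 else 1)"
      by (rule tga_krull_dim_qform) (use q[OF j] in simp)
    finally show "enat (if torsion (q j) then 2 else 1) = tga_krull_dim UNIV (tau j)" by simp
  qed simp
  finally show ?thesis .
qed

end
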